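(* Let $X$ be a separable complex Banach space and $T:X\to X$ a weakly mixing continuous linear operator. Then $T$ possesses a hypercyclic subspace if and only if $$\sup_{n\ge 1}\ \sup_{E\in \mathrm{cofin}}\ \inf_{x\in E\setminus\{0\}}\frac{\|T^nx\|}{\|x\|}\le 1,$$ or equivalently if and only if $$\sup_{n\ge 1}\ \sup_{E\in \mathrm{cofin}}\ \inf_{x\in E\setminus\{0\}}\frac{\|T^nx\|}{\|x\|}<\infty.$$
   Context: $\mathrm{cofin}$ denotes the set of all linear subspaces of $X$ of finite codimension. $T$ is weakly mixing if $T\oplus T$ is topologically transitive on $X\oplus X$. A vector $x$ is hypercyclic for $T$ if $\{T^nx:n\ge1\}$ is dense in $X$. A hypercyclic subspace for $T$ is an infinite-dimensional closed linear subspace of $X$ in which every non-zero vector is hypercyclic for $T$. *)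

theory Defs
  imports "HOL-Analysis.Analysis"
begin

text \<open>
  Complex Banach spaces, as a refinement of the library's (real) \<open>banach\<close> class by a scalar
  multiplication by complex numbers that extends the real one and is compatible with the norm.
\<close>

class complex_banach = banach +
  fixes scaleC :: "complex \<Rightarrow> 'a \<Rightarrow> 'a"  (infixr \<open>*\<^sub>C\<close> 75)
  assumes scaleC_add_right: "c *\<^sub>C (x + y) = c *\<^sub>C x + c *\<^sub>C y"
    and scaleC_add_left: "(c + d) *\<^sub>C x = c *\<^sub>C x + d *\<^sub>C x"
    and scaleC_scaleC: "c *\<^sub>C d *\<^sub>C x = (c * d) *\<^sub>C x"
    and scaleC_of_real: "complex_of_real r *\<^sub>C x = r *\<^sub>R x"
    and norm_scaleC: "norm (c *\<^sub>C x) = cmod c * norm x"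

text \<open>
  Complex subspaces, spans and linear maps are those of the library's \<open>vector_space\<close> locale.
  The prefix is mandatory: unprefixed \<open>subspace\<close>, \<open>span\<close> and \<open>linear\<close> remain the real notions.
\<close>

global_interpretation complex_vector:
  vector_space "scaleC :: complex \<Rightarrow> 'a \<Rightarrow> 'a::complex_banach"
proof
  fix x :: 'a
  show "1 *\<^sub>C x = x"
    using scaleC_of_real[of 1 x] by simp
qed (simp_all add: scaleC_add_right scaleC_add_left scaleC_scaleC)

definition topologically_transitive :: "('a::topological_space \<Rightarrow> 'a) \<Rightarrow> bool"
  where "topologically_transitive f \<longleftrightarrow>
    (\<forall>U V. open U \<and> U \<noteq> {} \<and> open V \<and> V \<noteq> {} \<longrightarrow> (\<exists>n. (f ^^ n) ` U \<inter> V \<noteq> {}))"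

definition weakly_mixing :: "('a::topological_space \<Rightarrow> 'a) \<Rightarrow> bool"
  where "weakly_mixing T \<longleftrightarrow> topologically_transitive (map_prod T T)"

definition hypercyclic_vector :: "('a::topological_space \<Rightarrow> 'a) \<Rightarrow> 'a \<Rightarrow> bool"
  where "hypercyclic_vector T x \<longleftrightarrow> closure {(T ^^ n) x | n. n \<ge> 1} = UNIV"

definition hypercyclic_subspace :: "('a::complex_banach \<Rightarrow> 'a) \<Rightarrow> 'a set \<Rightarrow> bool"
  where "hypercyclic_subspace T M \<longleftrightarrow>
    complex_vector.subspace M \<and> closed M \<and>
    \<not> (\<exists>B. finite B \<and> complex_vector.span B = M) \<and>
    (\<forall>x\<in>M. x \<noteq> 0 \<longrightarrow> hypercyclic_vector T x)"

text \<open>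
  The second condition says that the quotient by \<open>E\<close> is spanned by the classes of finitely
  many vectors. The subspaces are not required to be closed.
\<close>

definition cofin :: "'a::complex_banach set set"
  where "cofin = {E. complex_vector.subspace E \<and>
    (\<exists>B. finite B \<and> (\<forall>x. \<exists>b\<in>complex_vector.span B. x - b \<in> E))}"

end

theory Submission
  imports Defs
begin

text \<open>
  If some power of \<open>T\<close> expands a subspace of finite codimension by a factor \<open>C > 1\<close>, then the powers
  of \<open>T\<close> tend to infinity uniformly on suitable subspaces of finite codimension. Choosing unit vectors
  \<open>e k\<close> of \<open>M\<close> deep inside these subspaces, with almost orthogonal orbits in the sense of Mazur, the
  vector \<open>\<Sum>k. 2 ^ (-k) *\<^sub>C e k\<close> of \<open>M\<close> has an orbit bounded away from \<open>0\<close>.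

  Conversely, a finite supremum forces an approximate eigenvalue \<open>\<alpha>\<close> with \<open>\<bar>\<alpha>\<bar> \<le> 1\<close> on all subspaces
  of finite codimension. A sequence \<open>e k\<close> of approximate eigenvectors is chosen to be basic. Weak
  mixing gives small corrections \<open>z k\<close> of \<open>e k\<close> and times \<open>n s\<close> at which \<open>T\<close> sends one of the vectors
  \<open>z 0, \<dots>, z s\<close> near a prescribed target and the others near \<open>0\<close>. On the tail of a series in the
  \<open>z k\<close> the power of \<open>T\<close> acts almost as multiplication by \<open>\<alpha> ^ n s\<close>, so the tail is negligible.
\<close>

section \<open>Subspaces of finite codimension\<close>

text \<open>Both equivalences come from one cycle: a hypercyclic subspace, supremum at most 1,
  supremum finite, a hypercyclic subspace. So the supremum never lies strictly between 1 and
  infinity. The hard link is the approximate eigenvalue. If \<open>T\<close> has any positive lower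
  bound modulo finite codimension, its powers have a best exponential lower rate t, and a finite
  supremum gives t \<le> 1. Suppose T - \<alpha> were bounded below on finite codimension for every
  \<alpha> of modulus t. With G = 1 + X + ... + X^(q-1) and S = T/\<alpha>, the identity (S - 1)^k
  G(S)^k = (S^q - 1)^k bounds G(S)^k x along an orbit that grows at rate t, for the whole circle at
  once. Averaging over the circle, where complex scalars enter, bounds each single coefficient of
  G^k; but these sum to q^k, too much for large q. In the construction the coefficients a_k of a
  vector are merely bounded, so its tail is not small for reasons of size. Instead the series of a_k
  e_k converges together with that of a_k z_k, and a factor of modulus at most 1 does not enlarge
  its tails.\<close>

lemma complex_sum_span_modulo:
  fixes V W :: "'a::complex_banach set"
  assumes "finite B" "complex_vector.subspace V" "complex_vector.subspace W"
    and "\<forall>x\<in>V. \<exists>b\<in>complex_vector.span B. x - b \<in> W"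
  shows "\<exists>B'. finite B' \<and> B' \<subseteq> V \<and> (\<forall>x\<in>V. \<exists>b\<in>complex_vector.span B'. x - b \<in> V \<inter> W)"
  using assms(1,3,4)
proof (induction B arbitrary: W)
  case empty
  then show ?case by (intro exI[of _ "{}"]) (auto)
next
  case (insert b B)
  \<comment> \<open>W' is W plus the line of \<open>b\<close>. Hence V \<inter> W' exceeds V
    \<inter> W by at most one dimension, and a single vector \<open>v\<close> of V can take over the
    role of \<open>b\<close>. In this way the representatives get into V, although B need not lie
    there.\<close>
  define W' where "W' = {x. \<exists>c. x - c *\<^sub>C b \<in> W}"
  have W': "complex_vector.subspace W'"
    unfolding complex_vector.subspace_def
  proof (intro conjI allI ballI)
    show "0 \<in> W'" unfolding W'_def using insert.prems(1)
      by (auto intro!: exI[of _ 0] simp: complex_vector.subspace_0)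
    fix x assume x: "x \<in> W'"
    then obtain c where c: "x - c *\<^sub>C b \<in> W" by (auto simp: W'_def)
    { fix y assume "y \<in> W'"
      then obtain d where d: "y - d *\<^sub>C b \<in> W" by (auto simp: W'_def)
      have "x + y - (c + d) *\<^sub>C b = (x - c *\<^sub>C b) + (y - d *\<^sub>C b)"
        by (simp add: complex_vector.scale_left_distrib algebra_simps)
      then show "x + y \<in> W'" unfolding W'_def
        using complex_vector.subspace_add[OF insert.prems(1) c d]
        by (metis (mono_tags, lifting) mem_Collect_eq) }
    { fix k
      have "k *\<^sub>C x - (k * c) *\<^sub>C b = k *\<^sub>C (x - c *\<^sub>C b)"
        by (simp add: complex_vector.scale_right_diff_distrib)
      then show "k *\<^sub>C x \<in> W'" unfolding W'_def
        using complex_vector.subspace_scale[OF insert.prems(1) c, of k] by (auto intro!: exI[of _ "k*c"]) }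
  qed
  have "\<forall>x\<in>V. \<exists>b\<in>complex_vector.span B. x - b \<in> W'"
  proof
    fix x assume "x \<in> V"
    then obtain u where u: "u \<in> complex_vector.span (insert b B)" "x - u \<in> W" using insert.prems(2) by blast
    then obtain c where "u - c *\<^sub>C b \<in> complex_vector.span B" using complex_vector.span_breakdown_eq by blast
    moreover have "x - (u - c *\<^sub>C b) \<in> W'" unfolding W'_def using u(2) by (auto intro!: exI[of _ c])
    ultimately show "\<exists>b\<in>complex_vector.span B. x - b \<in> W'" by blast
  qed
  from insert.IH[OF W' this] obtain B' where B': "finite B'" "B' \<subseteq> V"
    "\<And>x. x \<in> V \<Longrightarrow> \<exists>b\<in>complex_vector.span B'. x - b \<in> V \<inter> W'" by blast
  show ?case
  proof (cases "V \<inter> W' \<subseteq> W")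
    case True
    then show ?thesis using B' by (intro exI[of _ B']) blast
  next
    case False
    then obtain v where v: "v \<in> V" "v \<in> W'" "v \<notin> W" by blast
    then obtain c where c: "v - c *\<^sub>C b \<in> W" by (auto simp: W'_def)
    have c0: "c \<noteq> 0" using c v by auto
    have "\<exists>u\<in>complex_vector.span (insert v B'). x - u \<in> V \<inter> W" if x: "x \<in> V" for x
    proof -
      obtain u where u: "u \<in> complex_vector.span B'" "x - u \<in> V" "x - u \<in> W'" using B'(3)[OF x] by blast
      obtain d where d: "x - u - d *\<^sub>C b \<in> W" using u(3) by (auto simp: W'_def)
      have "x - (u + (d/c) *\<^sub>C v) = (x - u - d *\<^sub>C b) - (d/c) *\<^sub>C (v - c *\<^sub>C b)"
        using c0 by (simp add: complex_vector.scale_right_diff_distrib algebra_simps)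
      then have 1: "x - (u + (d/c) *\<^sub>C v) \<in> W"
        using complex_vector.subspace_diff[OF insert.prems(1) d complex_vector.subspace_scale[OF insert.prems(1) c]] by metis
      have "x - (u + (d/c) *\<^sub>C v) = (x - u) - (d/c) *\<^sub>C v" by simp
      then have 2: "x - (u + (d/c) *\<^sub>C v) \<in> V"
        using complex_vector.subspace_diff[OF assms(2) u(2) complex_vector.subspace_scale[OF assms(2) v(1)]] by metis
      have "u + (d/c) *\<^sub>C v \<in> complex_vector.span (insert v B')"
        by (metis complex_vector.span_add complex_vector.span_base complex_vector.span_mono complex_vector.span_scale insertI1 subsetD subset_insertI u(1))
      with 1 2 show ?thesis by blast
    qed
    then show ?thesis using B' v by (intro exI[of _ "insert v B'"]) auto
  qed
qed

lemma cofin_subspace: "E \<in> cofin \<Longrightarrow> complex_vector.subspace E"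
  by (simp add: cofin_def)

lemma cofin_UNIV: "UNIV \<in> cofin"
  unfolding cofin_def using complex_vector.subspace_UNIV by (auto intro!: exI[of _ "{}"])

lemma cofin_relative:
  assumes "E \<in> cofin" "complex_vector.subspace V"
  obtains B where "finite B" "B \<subseteq> V" "\<And>x. x \<in> V \<Longrightarrow> \<exists>b\<in>complex_vector.span B. x - b \<in> V \<inter> E"
proof -
  obtain B where "finite B" "\<forall>x. \<exists>b\<in>complex_vector.span B. x - b \<in> E" using assms(1) by (auto simp: cofin_def)
  then show ?thesis
    using complex_sum_span_modulo[of B V E] assms(2) cofin_subspace[OF assms(1)] that by meson
qed

lemma cofin_Int:
  assumes "E \<in> cofin" "F \<in> cofin" shows "E \<inter> F \<in> cofin"
proof -
  obtain A where A: "finite A" "\<And>x. \<exists>b\<in>complex_vector.span A. x - b \<in> E" using assms(1) by (auto simp: cofin_def)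
  obtain B where B: "finite B" "B \<subseteq> E" "\<And>x. x \<in> E \<Longrightarrow> \<exists>b\<in>complex_vector.span B. x - b \<in> E \<inter> F"
    using cofin_relative[OF assms(2) cofin_subspace[OF assms(1)]] by metis
  have "\<exists>b\<in>complex_vector.span (A \<union> B). x - b \<in> E \<inter> F" for x
  proof -
    obtain a where a: "a \<in> complex_vector.span A" "x - a \<in> E" using A by blast
    obtain b where b: "b \<in> complex_vector.span B" "x - a - b \<in> E \<inter> F" using B(3)[OF a(2)] by blast
    have "a + b \<in> complex_vector.span (A \<union> B)"
      by (meson a(1) b(1) complex_vector.span_add complex_vector.span_mono in_mono inf_sup_ord(3) sup_ge2)
    moreover have "x - (a + b) \<in> E \<inter> F" using b(2) by (simp add: diff_diff_add)
    ultimately show ?thesis by blast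
  qed
  then show ?thesis unfolding cofin_def using A B assms
    by (auto simp: complex_vector.subspace_inter cofin_subspace intro!: exI[of _ "A \<union> B"])
qed

lemma cofin_INT:
  assumes "finite I" "\<And>i. i \<in> I \<Longrightarrow> E i \<in> cofin" shows "(\<Inter>i\<in>I. E i) \<in> cofin"
  using assms by (induction I) (auto simp: cofin_UNIV cofin_Int)

text \<open>\<open>T\<close> embeds the quotient by the preimage into the quotient by E.
  Representatives can be pulled back only if they lie in \<open>range T\<close>, which
  \<open>cofin_relative\<close> provides.\<close>

lemma cofin_vimage:
  assumes T: "Vector_Spaces.linear (*\<^sub>C) (*\<^sub>C) T" and E: "E \<in> cofin"
  shows "T -` E \<in> cofin"
proof -
  interpret T: Vector_Spaces.linear "(*\<^sub>C)" "(*\<^sub>C)" T by fact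
  have sub: "complex_vector.subspace (range T)"
    using T.subspace_image[OF complex_vector.subspace_UNIV] .
  obtain B where B: "finite B" "B \<subseteq> range T" "\<And>x. x \<in> range T \<Longrightarrow> \<exists>b\<in>complex_vector.span B. x - b \<in> range T \<inter> E"
    using cofin_relative[OF E sub] by metis
  obtain A where A: "finite A" "B = T ` A" using B(1,2) by (meson finite_subset_image)
  have "\<exists>a\<in>complex_vector.span A. x - a \<in> T -` E" for x
  proof -
    obtain b where b: "b \<in> complex_vector.span B" "T x - b \<in> E" using B(3)[of "T x"] by blast
    obtain a where a: "a \<in> complex_vector.span A" "b = T a" using b(1) A(2) T.span_image by auto
    show ?thesis using a b by (auto intro!: bexI[of _ a] simp: T.diff)
  qed
  moreover have "complex_vector.subspace (T -` E)"
    using T.subspace_vimage[OF cofin_subspace[OF E]] .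
  ultimately show ?thesis unfolding cofin_def using A by blast
qed

lemma cofin_inter_infinite_dim:
  assumes E: "E \<in> cofin" and M: "complex_vector.subspace M" "\<nexists>B. finite B \<and> complex_vector.span B = M"
  shows "\<exists>x. x \<in> M \<and> x \<in> E \<and> norm x = 1"
proof -
  obtain B where B: "finite B" "B \<subseteq> M" "\<And>x. x \<in> M \<Longrightarrow> \<exists>b\<in>complex_vector.span B. x - b \<in> M \<inter> E"
    using cofin_relative[OF E M(1)] by metis
  have "complex_vector.span B \<subseteq> M" using B(2) M(1) by (simp add: complex_vector.span_minimal)
  then obtain x where "x \<in> M" "x \<notin> complex_vector.span B" using M(2) B(1) by blast
  then obtain y where y: "y \<in> M" "y \<in> E" "y \<noteq> 0" using B(3)[of x] by force
  define u where "u = complex_of_real (1 / norm y) *\<^sub>C y"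
  have "norm u = 1" using y by (simp add: u_def norm_scaleC norm_divide)
  moreover have "u \<in> M \<and> u \<in> E"
    unfolding u_def using y complex_vector.subspace_scale M(1) cofin_subspace[OF E] by blast
  ultimately show ?thesis by blast
qed

lemma cofin_kernel:
  fixes g :: "'a::complex_banach \<Rightarrow> complex"
  assumes add: "\<And>x y. g (x + y) = g x + g y" and scale: "\<And>c x. g (c *\<^sub>C x) = c * g x"
  shows "{x. g x = 0} \<in> cofin"
proof -
  have g0: "g 0 = 0" using scale[of 0 0] by simp
  have sub: "complex_vector.subspace {x. g x = 0}"
    by (auto simp: complex_vector.subspace_def add scale g0)
  show ?thesis
  proof (cases "\<forall>x. g x = 0")
    case True
    then show ?thesis by (simp add: cofin_UNIV)
  next
    case False
    then obtain v where v: "g v \<noteq> 0" by blast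
    have diff: "g (x - c *\<^sub>C v) = g x - c * g v" for x c
      using add[of x "(-c) *\<^sub>C v"] scale[of "-c" v] by simp
    have "\<exists>b\<in>complex_vector.span {v}. x - b \<in> {x. g x = 0}" for x
      using v by (intro bexI[of _ "(g x / g v) *\<^sub>C v"])
        (auto simp: diff complex_vector.span_base complex_vector.span_scale)
    with sub show ?thesis unfolding cofin_def by (auto intro!: exI[of _ "{v}"])
  qed
qed

section \<open>The Hahn-Banach theorem and almost orthogonal complements\<close>

definition sublinear :: "('a::real_vector \<Rightarrow> real) \<Rightarrow> bool" where
  "sublinear q \<longleftrightarrow> (\<forall>x y. q (x + y) \<le> q x + q y) \<and> (\<forall>s>0. \<forall>x. q (s *\<^sub>R x) = s * q x)"

lemma sublinear_add: "sublinear q \<Longrightarrow> q (x + y) \<le> q x + q y"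
  and sublinear_scale: "sublinear q \<Longrightarrow> s > 0 \<Longrightarrow> q (s *\<^sub>R x) = s * q x"
  by (auto simp: sublinear_def)

lemma sublinear_0: "sublinear q \<Longrightarrow> q 0 = 0"
  using sublinear_scale[of q 2 0] by simp

lemma sublinear_lower: "sublinear q \<Longrightarrow> - q (- x) \<le> q x"
  using sublinear_add[of q x "-x"] sublinear_0[of q] by simp

lemma sublinearI:
  assumes "\<And>x y. q (x + y) \<le> q x + q y" "\<And>s x. s > 0 \<Longrightarrow> q (s *\<^sub>R x) \<le> s * q x"
  shows "sublinear q"
  unfolding sublinear_def
proof (intro conjI allI impI antisym assms)
  fix s :: real and x assume s: "s > 0"
  have "q (inverse s *\<^sub>R s *\<^sub>R x) \<le> inverse s * q (s *\<^sub>R x)" using s by (intro assms) simp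
  then show "s * q x \<le> q (s *\<^sub>R x)" using s by (simp add: field_simps)
qed auto

text \<open>Serves two infima: over a chain of sublinear functionals, and over the parameter of a
  shift, where the single members need not be sublinear. Therefore the hypotheses compare members
  with different indices.\<close>

lemma sublinear_INF:
  assumes "I \<noteq> {}" "\<And>x. bdd_below ((\<lambda>i. p i x) ` I)"
    and add: "\<And>i j x y. i \<in> I \<Longrightarrow> j \<in> I \<Longrightarrow> \<exists>k\<in>I. p k (x + y) \<le> p i x + p j y"
    and scale: "\<And>i s x. i \<in> I \<Longrightarrow> s > 0 \<Longrightarrow> \<exists>k\<in>I. p k (s *\<^sub>R x) \<le> s * p i x"
  shows "sublinear (\<lambda>x. INF i\<in>I. p i x)"
proof (rule sublinearI)
  fix x y
  have "(INF i\<in>I. p i (x + y)) - p i x \<le> (INF i\<in>I. p i y)" if i: "i \<in> I" for i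
  proof (rule cINF_greatest[OF assms(1)])
    fix j assume "j \<in> I"
    then obtain k where "k \<in> I" "p k (x + y) \<le> p i x + p j y" using add[OF i, of j x y] by auto
    then show "(INF i\<in>I. p i (x + y)) - p i x \<le> p j y"
      using cINF_lower[OF assms(2), of k "x+y"] by simp
  qed
  then have "(INF i\<in>I. p i (x + y)) - (INF i\<in>I. p i y) \<le> (INF i\<in>I. p i x)"
    by (intro cINF_greatest assms(1)) force
  then show "(INF i\<in>I. p i (x + y)) \<le> (INF i\<in>I. p i x) + (INF i\<in>I. p i y)" by simp
next
  fix s :: real and x assume s: "s > 0"
  have "(INF i\<in>I. p i (s *\<^sub>R x)) / s \<le> (INF i\<in>I. p i x)"
  proof (rule cINF_greatest[OF assms(1)])
    fix i assume "i \<in> I"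
    then obtain k where "k \<in> I" "p k (s *\<^sub>R x) \<le> s * p i x" using scale[OF _ s, of i x] by auto
    then show "(INF i\<in>I. p i (s *\<^sub>R x)) / s \<le> p i x"
      using cINF_lower[OF assms(2), of k "s *\<^sub>R x"] s by (simp add: field_simps)
  qed
  then show "(INF i\<in>I. p i (s *\<^sub>R x)) \<le> s * (INF i\<in>I. p i x)" using s by (simp add: field_simps)
qed

text \<open>The infimum over t \<ge> 0 of q (x + t y) - t q y. The parameter 0 gives the first bound
  and 1 the second; the whole half-line is used because it is stable under sums and positive
  multiples.\<close>

lemma sublinear_shift:
  assumes q: "sublinear q"
  obtains r where "sublinear r" "\<And>x. r x \<le> q x" "\<And>x. r x \<le> q (x + y) - q y"
proof
  let ?p = "\<lambda>t x. q (x + t *\<^sub>R y) - t * q y"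
  let ?r = "\<lambda>x. INF t\<in>{0..}. ?p t x"
  have bdd: "bdd_below ((\<lambda>t. ?p t x) ` {0..})" for x
  proof (rule bdd_belowI2)
    fix t :: real assume t: "t \<in> {0..}"
    have "q (t *\<^sub>R y) \<le> q (x + t *\<^sub>R y) + q (- x)" using sublinear_add[OF q, of "x + t *\<^sub>R y" "-x"] by simp
    moreover have "q (t *\<^sub>R y) = t * q y" using t sublinear_scale[OF q] sublinear_0[OF q] by (cases "t = 0") auto
    ultimately show "- q (- x) \<le> ?p t x" by simp
  qed
  show "sublinear ?r"
  proof (rule sublinear_INF[OF _ bdd])
    fix i j :: real and x z assume "i \<in> {0..}" "j \<in> {0..}"
    then show "\<exists>k\<in>{0..}. ?p k (x + z) \<le> ?p i x + ?p j z"
      using sublinear_add[OF q, of "x + i *\<^sub>R y" "z + j *\<^sub>R y"]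
      by (intro bexI[of _ "i + j"]) (auto simp: algebra_simps)
  next
    fix i s :: real and x assume "i \<in> {0..}" and s: "s > 0"
    then show "\<exists>k\<in>{0..}. ?p k (s *\<^sub>R x) \<le> s * ?p i x"
      using sublinear_scale[OF q s, of "x + i *\<^sub>R y"]
      by (intro bexI[of _ "s * i"]) (auto simp: algebra_simps)
  qed auto
  show "?r x \<le> q x" for x using cINF_lower[OF bdd, of 0 x] by simp
  show "?r x \<le> q (x + y) - q y" for x using cINF_lower[OF bdd, of 1 x] by simp
qed

text \<open>A sublinear functional that is minimal for the pointwise order is additive, because it
  coincides with all of its shifts.\<close>

lemma sublinear_dominates_linear:
  fixes p :: "'a::real_vector \<Rightarrow> real"
  assumes p: "sublinear p"
  obtains f where "linear f" "\<And>x. f x \<le> p x"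
proof -
  let ?A = "{q. sublinear q \<and> (\<forall>x. q x \<le> p x)}"
  \<comment> \<open>The order is reversed, so that Zorn's lemma yields a pointwise minimal
    functional.\<close>
  let ?P = "\<lambda>a b :: 'a \<Rightarrow> real. \<forall>x. b x \<le> a x"
  have "\<exists>m\<in>?A. \<forall>a\<in>?A. ?P m a \<longrightarrow> a = m"
  proof (rule predicate_Zorn)
    show "partial_order_on ?A (relation_of ?P ?A)"
      by (rule partial_order_on_relation_ofI) (auto simp: fun_eq_iff intro: order_trans antisym)
    fix C assume C: "C \<in> Chains (relation_of ?P ?A)"
    then have CA: "C \<subseteq> ?A" and chain: "\<And>a b. a \<in> C \<Longrightarrow> b \<in> C \<Longrightarrow> ?P a b \<or> ?P b a"
      by (auto simp: Chains_def relation_of_def)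
    show "\<exists>u\<in>?A. \<forall>a\<in>C. ?P a u"
    proof (cases "C = {}")
      case True then show ?thesis using p by auto
    next
      case False
      have bdd: "bdd_below ((\<lambda>q. q x) ` C)" for x
      proof (rule bdd_belowI2)
        fix q assume "q \<in> C"
        then have "sublinear q" "q (-x) \<le> p (-x)" using CA by auto
        then show "- p (- x) \<le> q x" using sublinear_lower[of q x] by simp
      qed
      have "sublinear (\<lambda>x. INF q\<in>C. q x)"
      proof (rule sublinear_INF[OF False bdd])
        fix i j x y assume ij: "i \<in> C" "j \<in> C"
        then have "sublinear i" "sublinear j" using CA by auto
        then show "\<exists>k\<in>C. k (x + y) \<le> i x + j y"
          using chain[OF ij] ij sublinear_add[of i x y] sublinear_add[of j x y]
          by (meson add_mono_thms_linordered_semiring(2) add_mono_thms_linordered_semiring(3) order_trans)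
      next
        fix i s x assume "i \<in> C" "(s::real) > 0"
        then show "\<exists>k\<in>C. k (s *\<^sub>R x) \<le> s * i x" using CA sublinear_scale[of i s x] by (intro bexI[of _ i]) auto
      qed
      moreover have low: "(INF q\<in>C. q x) \<le> a x" if "a \<in> C" for a x
        using cINF_lower[OF bdd that] .
      moreover obtain a where "a \<in> C" using False by blast
      then have "(INF q\<in>C. q x) \<le> p x" for x using low[of a x] CA by (auto intro: order_trans)
      ultimately show ?thesis by (intro bexI[of _ "\<lambda>x. INF q\<in>C. q x"]) auto
    qed
  qed
  then obtain q where q: "sublinear q" "\<And>x. q x \<le> p x"
    and min: "\<And>r. sublinear r \<Longrightarrow> (\<And>x. r x \<le> q x) \<Longrightarrow> r = q"
    by simp (metis order_trans)
  have add: "q (x + y) = q x + q y" for x y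
  proof -
    obtain r where r: "sublinear r" "\<And>x. r x \<le> q x" "\<And>x. r x \<le> q (x + y) - q y"
      using sublinear_shift[OF q(1)] by metis
    then have "r = q" using min by blast
    then show ?thesis using r(3)[of x] sublinear_add[OF q(1), of x y] by simp
  qed
  have neg: "q (- x) = - q x" for x using add[of x "-x"] sublinear_0[OF q(1)] by simp
  have "q (s *\<^sub>R x) = s * q x" for s x
  proof -
    consider "s = 0" | "s > 0" | "- s > 0" by linarith
    then show ?thesis
      using sublinear_scale[OF q(1), of s x] sublinear_scale[OF q(1), of "-s" x] sublinear_0[OF q(1)] neg
      by cases auto
  qed
  then have "linear q" using add by (intro linearI) auto
  then show ?thesis using q(2) that by blast
qed

text \<open>The functional is dominated by the shift of the norm by \<open>y\<close> rather than by
  the norm: at -y this shift is at most - norm y, which forces the value at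
  \<open>y\<close>.\<close>

lemma norming_functional:
  fixes y :: "'a::real_normed_vector"
  obtains f where "linear f" "\<And>x. f x \<le> norm x" "f y = norm y"
proof -
  have "sublinear (norm :: 'a \<Rightarrow> real)" by (auto simp: sublinear_def norm_triangle_ineq)
  then obtain r where r: "sublinear r" "\<And>x::'a. r x \<le> norm x" "\<And>x. r x \<le> norm (x + y) - norm y"
    using sublinear_shift by metis
  obtain f where f: "linear f" "\<And>x. f x \<le> r x" using sublinear_dominates_linear[OF r(1)] by metis
  have "f (- y) \<le> - norm y" using f(2)[of "-y"] r(3)[of "-y"] by simp
  then have "norm y \<le> f y" using f(1) by (simp add: linear_neg)
  then show ?thesis using f r(2) that by (metis antisym order_trans)
qed

text \<open>The real functional \<open>f\<close> norming \<open>y\<close> is the real part of the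
  complex functional f x - i f (i x), so it vanishes on a complex subspace of codimension at most
  one. For z there, norm y = f (u + z) + f (y - u). The free \<open>u\<close> allows
  \<open>y\<close> to be a point of a net close to the vector of interest.\<close>

lemma norming_cofin:
  fixes y :: "'a::complex_banach"
  obtains L where "L \<in> cofin" "\<And>u z. z \<in> L \<Longrightarrow> norm y \<le> norm (u + z) + norm (y - u)"
proof -
  obtain f where f: "linear f" "\<And>x. f x \<le> norm x" "f y = norm y" using norming_functional by metis
  interpret f: linear f by fact
  define g where "g x = Complex (f x) (- f (\<i> *\<^sub>C x))" for x
  have fc: "f (c *\<^sub>C x) = Re c * f x + Im c * f (\<i> *\<^sub>C x)" for c x
  proof -
    have "c *\<^sub>C x = Re c *\<^sub>R x + Im c *\<^sub>R (\<i> *\<^sub>C x)"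
      unfolding scaleC_of_real[symmetric] scaleC_scaleC scaleC_add_left[symmetric]
      by (simp add: complex_eq[symmetric] mult.commute)
    then show ?thesis by (simp add: f.add f.scale)
  qed
  have "{x. g x = 0} \<in> cofin"
  proof (rule cofin_kernel)
    show "g (x + y) = g x + g y" for x y by (simp add: g_def f.add complex_vector.scale_right_distrib complex_eq_iff)
    show "g (c *\<^sub>C x) = c * g x" for c x
      by (simp add: g_def complex_eq_iff fc[of c] fc[of "\<i> * c"])
  qed
  moreover have "norm y \<le> norm (u + z) + norm (y - u)" if "z \<in> {x. g x = 0}" for u z
  proof -
    have "f z = 0" using that by (simp add: g_def complex_eq_iff)
    then have "f y = f (u + z) + f (y - u)" by (simp add: f.add f.diff)
    then show ?thesis using f(2)[of "u + z"] f(2)[of "y - u"] f(3) by linarith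
  qed
  ultimately show ?thesis using that by blast
qed

text \<open>A compact superset of the unit ball within the span suffices for total boundedness and
  carries the induction: the next vector \<open>b\<close> has positive distance d to the span, so
  its coefficient in a vector of norm at most 1 is at most 1/d.\<close>

lemma finite_dim_ball_compact:
  fixes B :: "'a::complex_banach set"
  assumes "finite B"
  shows "\<exists>Q. compact Q \<and> Q \<subseteq> complex_vector.span B \<and> {y \<in> complex_vector.span B. norm y \<le> 1} \<subseteq> Q"
  using assms
proof (induction B)
  case empty
  then show ?case by (intro exI[of _ "{0}"]) auto
next
  case (insert b B)
  then obtain Q where Q: "compact Q" "Q \<subseteq> complex_vector.span B" "{y \<in> complex_vector.span B. norm y \<le> 1} \<subseteq> Q" by blast
  define Qs where "Qs r = (\<lambda>x. r *\<^sub>R x) ` Q" for r :: real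
  have Qs: "compact (Qs r)" "Qs r \<subseteq> complex_vector.span B" for r
    using Q(1,2) compact_scaling[OF Q(1), of r] complex_vector.span_scale[of _ B "complex_of_real r"]
    unfolding Qs_def by (auto simp: scaleC_of_real)
  have Qs2: "y \<in> Qs r" if "y \<in> complex_vector.span B" "norm y \<le> r" "r > 0" for y r
  proof -
    have "(1/r) *\<^sub>R y \<in> Q" using Q(3) that
      by (auto simp: scaleC_of_real[symmetric] norm_scaleC norm_divide intro!: complex_vector.span_scale)
    then show ?thesis unfolding Qs_def using that by (auto simp: image_iff intro!: bexI[of _ "(1/r) *\<^sub>R y"])
  qed
  show ?case
  proof (cases "b \<in> complex_vector.span B")
    case True
    then show ?thesis using Q by (intro exI[of _ Q]) (auto simp: complex_vector.span_redundant)
  next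
    case False
    \<comment> \<open>Points of the span at distance below 1 from \<open>b\<close> have norm at most
      norm b + 1, hence lie in this closed set, which misses \<open>b\<close>.\<close>
    have "b \<notin> Qs (norm b + 1)" using False Qs by blast
    moreover have "closed (Qs (norm b + 1))" using Qs compact_imp_closed by blast
    ultimately obtain e where e: "e > 0" "ball b e \<subseteq> - Qs (norm b + 1)"
      by (meson ComplI open_Compl open_contains_ball)
    define d where "d = min e 1"
    have d0: "d > 0" using e by (simp add: d_def)
    have d: "norm (b - y) \<ge> d" if "y \<in> complex_vector.span B" for y
    proof (rule ccontr)
      assume "\<not> norm (b - y) \<ge> d"
      then have *: "norm (b - y) < e" "norm (b - y) < 1" by (auto simp: d_def)
      then have "norm y \<le> norm b + 1" using norm_triangle_ineq2[of y b] by (simp add: norm_minus_commute)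
      then have "y \<in> Qs (norm b + 1)" using that by (intro Qs2) (auto intro: add_nonneg_pos)
      then show False using e(2) * by (auto simp: dist_norm)
    qed
    define R where "R = 1 + norm b / d"
    define Q' where "Q' = {x + y |x y. x \<in> Qs R \<and> y \<in> (\<lambda>c. c *\<^sub>C b) ` cball 0 (1/d)}"
    have "compact ((\<lambda>c. c *\<^sub>C b) ` cball 0 (1/d))"
    proof (intro compact_continuous_image)
      have "bounded_linear (\<lambda>c. c *\<^sub>C b)"
        by (rule bounded_linear_intro[of _ "norm b"])
          (auto simp: scaleC_add_left norm_scaleC scaleC_of_real[symmetric] scaleC_scaleC scaleR_conv_of_real)
      then show "continuous_on (cball 0 (1/d)) (\<lambda>c. c *\<^sub>C b)"
        by (rule linear_continuous_on)
    qed auto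
    then have "compact Q'" unfolding Q'_def using Qs(1) by (intro compact_sums)
    moreover have "Q' \<subseteq> complex_vector.span (insert b B)"
    proof -
      have "x \<in> complex_vector.span (insert b B)" if "x \<in> Qs R" for x
        using Qs(2) that complex_vector.span_mono[of B "insert b B"] by blast
      moreover have "c *\<^sub>C b \<in> complex_vector.span (insert b B)" for c
        by (simp add: complex_vector.span_base complex_vector.span_scale)
      ultimately show ?thesis unfolding Q'_def by (auto intro: complex_vector.span_add)
    qed
    moreover have "y \<in> Q'" if y: "y \<in> complex_vector.span (insert b B)" "norm y \<le> 1" for y
    proof -
      obtain c where c: "y - c *\<^sub>C b \<in> complex_vector.span B" using y(1) complex_vector.span_breakdown_eq by blast
      have cd: "cmod c * d \<le> 1"
      proof (cases "c = 0")
        case False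
        have "d \<le> norm (b - (-1/c) *\<^sub>C (y - c *\<^sub>C b))" using c by (intro d complex_vector.span_scale)
        also have "b - (-1/c) *\<^sub>C (y - c *\<^sub>C b) = (1/c) *\<^sub>C y"
          using False by (simp add: complex_vector.scale_right_diff_distrib)
        finally have "d \<le> norm y / cmod c" by (simp add: norm_scaleC norm_divide)
        then show ?thesis using y(2) False by (simp add: field_simps)
      qed auto
      have cd': "cmod c \<le> 1/d" using cd d0 by (simp add: field_simps)
      have "norm (y - c *\<^sub>C b) \<le> norm y + cmod c * norm b"
        using norm_triangle_ineq4[of y "c *\<^sub>C b"] by (simp add: norm_scaleC)
      also have "\<dots> \<le> R" unfolding R_def using y(2) cd' mult_right_mono[OF cd', of "norm b"] by auto
      finally have "norm (y - c *\<^sub>C b) \<le> R" .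
      moreover have "R > 0" using d0 by (auto simp: R_def intro: add_pos_nonneg)
      ultimately have "y - c *\<^sub>C b \<in> Qs R" using c by (intro Qs2)
      moreover have "c *\<^sub>C b \<in> (\<lambda>c. c *\<^sub>C b) ` cball 0 (1/d)" using cd' by auto
      ultimately show ?thesis unfolding Q'_def
        by (intro CollectI exI[of _ "y - c *\<^sub>C b"] exI[of _ "c *\<^sub>C b"]) auto
    qed
    ultimately show ?thesis by blast
  qed
qed

text \<open>Mazur's argument: the kernels of functionals norming a finite 1/4-net of the unit ball
  are intersected. Passing to the net and back costs 1/4 twice, so a unit vector y keeps norm (y +
  z) \<ge> 1/2, whence the factor 2.\<close>

lemma almost_orthogonal_cofin:
  fixes B :: "'a::complex_banach set"
  assumes "finite B"
  shows "\<exists>L\<in>cofin. \<forall>y\<in>complex_vector.span B. \<forall>z\<in>L. norm y \<le> 2 * norm (y + z)"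
proof -
  obtain Q where Q: "compact Q" "{y \<in> complex_vector.span B. norm y \<le> 1} \<subseteq> Q"
    using finite_dim_ball_compact[OF assms] by blast
  obtain N where N: "finite N" "Q \<subseteq> (\<Union>k\<in>N. ball k (1/4))"
    using seq_compact_imp_totally_bounded[of Q] Q(1) by (metis compact_imp_seq_compact zero_less_divide_1_iff zero_less_numeral)
  obtain L :: "'a \<Rightarrow> 'a set" where L: "\<And>k. L k \<in> cofin" "\<And>k u z. z \<in> L k \<Longrightarrow> norm k \<le> norm (u + z) + norm (k - u)"
    using norming_cofin by metis
  have unit: "1 \<le> 2 * norm (y + z)" if y: "y \<in> complex_vector.span B" "norm y = 1" and z: "z \<in> (\<Inter>k\<in>N. L k)" for y z
  proof -
    obtain k where k: "k \<in> N" "norm (k - y) < 1/4" using Q(2) N(2) y by (force simp: dist_norm)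
    have "norm k \<le> norm (y + z) + norm (k - y)" using L(2) z k(1) by blast
    moreover have "norm y \<le> norm k + norm (k - y)" using norm_triangle_ineq2[of y k] by (simp add: norm_minus_commute)
    ultimately show ?thesis using y(2) k(2) by simp
  qed
  have cof: "(\<Inter>k\<in>N. L k) \<in> cofin" using N(1) L(1) by (intro cofin_INT)
  have "norm y \<le> 2 * norm (y + z)" if y: "y \<in> complex_vector.span B" and z: "z \<in> (\<Inter>k\<in>N. L k)" for y z
  proof (cases "y = 0")
    case False
    let ?c = "complex_of_real (1 / norm y)"
    have "1 \<le> 2 * norm (?c *\<^sub>C y + ?c *\<^sub>C z)"
    proof (rule unit)
      show "?c *\<^sub>C z \<in> (\<Inter>k\<in>N. L k)" using z cofin_subspace[OF cof] complex_vector.subspace_scale by blast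
    qed (use y False in \<open>auto simp: norm_scaleC norm_divide intro!: complex_vector.span_scale\<close>)
    also have "\<dots> = 2 * norm (?c *\<^sub>C (y + z))" by (simp only: scaleC_add_right)
    also have "\<dots> = 2 * norm (y + z) / norm y" by (simp add: norm_scaleC norm_divide)
    finally show ?thesis using False by (simp add: field_simps)
  qed auto
  with cof show ?thesis by blast
qed

section \<open>Basic sequences\<close>

lemma bounded_linear_scaleC_right: "bounded_linear (\<lambda>x::'a::complex_banach. c *\<^sub>C x)"
proof (rule bounded_linear_intro[of _ "cmod c"])
  show "c *\<^sub>C r *\<^sub>R x = r *\<^sub>R c *\<^sub>C x" for r and x :: 'a
    unfolding scaleC_of_real[symmetric] scaleC_scaleC by (simp add: mult.commute)
qed (auto simp: scaleC_add_right norm_scaleC mult.commute)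

lemma sums_scaleC: "f sums x \<Longrightarrow> (\<lambda>k. c *\<^sub>C f k) sums (c *\<^sub>C x :: 'a::complex_banach)"
  by (rule bounded_linear.sums[OF bounded_linear_scaleC_right])

text \<open>Grunblum's criterion for a basic sequence.\<close>

locale basic_seq =
  fixes z :: "nat \<Rightarrow> 'a::complex_banach" and K :: real
  assumes basis: "\<And>a m n. m \<le> n \<Longrightarrow> norm (\<Sum>k<m. a k *\<^sub>C z k) \<le> K * norm (\<Sum>k<n. a k *\<^sub>C z k)"
    and nonzero: "\<And>k. z k \<noteq> 0"
begin

text \<open>Described by convergent series, so that every element comes with coefficients;
  closedness is then a matter of proof.\<close>

definition series_space :: "'a set"
  where "series_space = {x. \<exists>a. (\<lambda>k. a k *\<^sub>C z k) sums x}"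

lemma K_ge_1: "1 \<le> K"
  using basis[of 1 1 "\<lambda>_. 1"] nonzero[of 0] by simp

lemma partial_sum_bound:
  assumes "(\<lambda>k. a k *\<^sub>C z k) sums x" shows "norm (\<Sum>k<m. a k *\<^sub>C z k) \<le> K * norm x"
proof (rule LIMSEQ_le_const)
  show "(\<lambda>n. K * norm (\<Sum>k<n. a k *\<^sub>C z k)) \<longlonglongrightarrow> K * norm x"
    using assms unfolding sums_def by (intro tendsto_intros)
  show "\<exists>N. \<forall>n\<ge>N. norm (\<Sum>k<m. a k *\<^sub>C z k) \<le> K * norm (\<Sum>k<n. a k *\<^sub>C z k)"
    using basis by blast
qed

lemma coeff_bound:
  assumes "(\<lambda>k. a k *\<^sub>C z k) sums x" shows "cmod (a k) * norm (z k) \<le> 2 * K * norm x"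
proof -
  have "norm (a k *\<^sub>C z k) = norm ((\<Sum>k<Suc k. a k *\<^sub>C z k) - (\<Sum>k<k. a k *\<^sub>C z k))" by simp
  also have "\<dots> \<le> K * norm x + K * norm x"
    using norm_triangle_ineq4 partial_sum_bound[OF assms] by (meson add_mono order_trans)
  finally show ?thesis by (simp add: norm_scaleC)
qed

lemma subspace_series_space: "complex_vector.subspace series_space"
  unfolding complex_vector.subspace_def
proof (intro conjI ballI allI)
  show "0 \<in> series_space" unfolding series_space_def
    by (auto intro!: exI[of _ "\<lambda>_. 0"])
  fix x assume "x \<in> series_space"
  then obtain a where a: "(\<lambda>k. a k *\<^sub>C z k) sums x" by (auto simp: series_space_def)
  show "c *\<^sub>C x \<in> series_space" for c
    using sums_scaleC[OF a, of c] unfolding series_space_def by (auto intro!: exI[of _ "\<lambda>k. c * a k"])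
  fix y assume "y \<in> series_space"
  then obtain b where b: "(\<lambda>k. b k *\<^sub>C z k) sums y" by (auto simp: series_space_def)
  show "x + y \<in> series_space"
    using sums_add[OF a b] unfolding series_space_def scaleC_add_left[symmetric] by auto
qed

text \<open>The coefficients depend on the sum in a bounded way, so those of a convergent sequence
  of sums converge, and the limits are coefficients of the limit.\<close>

lemma closed_series_space: "closed series_space"
  unfolding closed_sequential_limits
proof (intro allI impI, elim conjE)
  fix X x assume "\<forall>n. X n \<in> series_space" and lim: "X \<longlonglongrightarrow> x"
  then obtain a where a: "\<And>n. (\<lambda>k. a n k *\<^sub>C z k) sums X n"
    unfolding series_space_def mem_Collect_eq by metis
  have diff: "(\<lambda>k. (a i k - a j k) *\<^sub>C z k) sums (X i - X j)" for i j
    using sums_diff[OF a a] by (simp add: complex_vector.scale_left_diff_distrib)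
  have "\<exists>b. (\<lambda>n. a n k) \<longlonglongrightarrow> b" for k
  proof -
    have "Cauchy (\<lambda>n. a n k)"
    proof (rule metric_CauchyI)
      fix e :: real assume e: "e > 0"
      define e' where "e' = e * norm (z k) / (2 * K)"
      have "e' > 0" using e nonzero K_ge_1 by (simp add: e'_def)
      then obtain N where N: "\<And>m n. m \<ge> N \<Longrightarrow> n \<ge> N \<Longrightarrow> dist (X m) (X n) < e'"
        using lim LIMSEQ_imp_Cauchy metric_CauchyD by metis
      have "dist (a m k) (a n k) < e" if "m \<ge> N" "n \<ge> N" for m n
      proof -
        have "cmod (a m k - a n k) * norm (z k) \<le> 2 * K * norm (X m - X n)" by (rule coeff_bound[OF diff])
        also have "\<dots> < 2 * K * e'" using N[OF that] K_ge_1 by (simp add: dist_norm)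
        also have "\<dots> = e * norm (z k)" using K_ge_1 by (simp add: e'_def)
        finally show ?thesis using nonzero[of k] by (simp add: dist_norm)
      qed
      then show "\<exists>M. \<forall>m\<ge>M. \<forall>n\<ge>M. dist (a m k) (a n k) < e" by blast
    qed
    then show ?thesis using Cauchy_convergent_iff convergent_def by blast
  qed
  then obtain b where b: "\<And>k. (\<lambda>n. a n k) \<longlonglongrightarrow> b k" by metis
  \<comment> \<open>Letting j tend to infinity in \<open>partial_sum_bound\<close> gives a bound
    uniform in \<open>m\<close>, which permits the exchange of the limits in \<open>i\<close> and
    \<open>m\<close>.\<close>
  have near: "norm (\<Sum>k<m. (a i k - b k) *\<^sub>C z k) \<le> K * norm (X i - x)" for i m
  proof (rule LIMSEQ_le)
    have bl: "bounded_linear (\<lambda>c. c *\<^sub>C z k)" for k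
      by (rule bounded_linear_intro[of _ "norm (z k)"])
        (auto simp: scaleC_add_left norm_scaleC scaleC_of_real[symmetric] scaleC_scaleC scaleR_conv_of_real)
    show "(\<lambda>j. norm (\<Sum>k<m. (a i k - a j k) *\<^sub>C z k)) \<longlonglongrightarrow> norm (\<Sum>k<m. (a i k - b k) *\<^sub>C z k)"
      by (intro tendsto_norm tendsto_sum bounded_linear.tendsto[OF bl] tendsto_diff tendsto_const b)
    show "(\<lambda>j. K * norm (X i - X j)) \<longlonglongrightarrow> K * norm (X i - x)"
      by (intro tendsto_intros lim)
    show "\<exists>N. \<forall>j\<ge>N. norm (\<Sum>k<m. (a i k - a j k) *\<^sub>C z k) \<le> K * norm (X i - X j)"
      using partial_sum_bound[OF diff] by blast
  qed
  have "(\<lambda>k. b k *\<^sub>C z k) sums x"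
    unfolding sums_def
  proof (rule metric_LIMSEQ_I)
    fix e :: real assume e: "e > 0"
    then have "e / (3 * K) > 0" using K_ge_1 by simp
    then obtain i where i: "norm (X i - x) < e / (3 * K)" using metric_LIMSEQ_D[OF lim] by (metis dist_norm order_refl)
    have i2: "K * norm (X i - x) < e / 3" using i K_ge_1 by (simp add: field_simps)
    have i1: "norm (X i - x) < e / 3" using i2 K_ge_1 mult_right_mono[of 1 K "norm (X i - x)"] by simp
    obtain N where N: "\<And>m. m \<ge> N \<Longrightarrow> dist (\<Sum>k<m. a i k *\<^sub>C z k) (X i) < e / 3"
      using metric_LIMSEQ_D[OF a[of i, unfolded sums_def], of "e/3"] e by auto
    have "dist (\<Sum>k<m. b k *\<^sub>C z k) x < e" if m: "m \<ge> N" for m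
    proof -
      have "(\<Sum>k<m. b k *\<^sub>C z k) - x = ((\<Sum>k<m. a i k *\<^sub>C z k) - X i) + (X i - x) - (\<Sum>k<m. (a i k - b k) *\<^sub>C z k)"
        by (simp add: complex_vector.scale_left_diff_distrib sum_subtractf)
      also have "norm \<dots> \<le> norm ((\<Sum>k<m. a i k *\<^sub>C z k) - X i) + norm (X i - x) + norm (\<Sum>k<m. (a i k - b k) *\<^sub>C z k)"
        by (meson add_right_mono norm_triangle_ineq norm_triangle_ineq4 order_trans)
      also have "\<dots> < e" using near[where i=i and m=m] i1 i2 N[OF m] by (simp add: dist_norm)
      finally show ?thesis by (simp add: dist_norm)
    qed
    then show "\<exists>N. \<forall>m\<ge>N. dist (\<Sum>k<m. b k *\<^sub>C z k) x < e" by blast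
  qed
  then show "x \<in> series_space" by (auto simp: series_space_def)
qed

lemma finite_combination_zero:
  assumes "(\<Sum>k<n. a k *\<^sub>C z k) = 0" "k < n" shows "a k = 0"
proof -
  have "(\<Sum>k<m. a k *\<^sub>C z k) = 0" if "m \<le> n" for m using basis[OF that, of a] assms by simp
  from this[of k] this[of "Suc k"] assms(2) nonzero[of k] show ?thesis by simp
qed

lemma infinite_dim_series_space: "\<not> (\<exists>B. finite B \<and> complex_vector.span B = series_space)"
proof
  assume "\<exists>B. finite B \<and> complex_vector.span B = series_space"
  then obtain B where B: "finite B" "complex_vector.span B = series_space" by blast
  have inj: "inj z"
  proof (rule injI, rule ccontr)
    fix i j assume ij: "z i = z j" "i \<noteq> j"
    define a where "a k = (if k = i then 1 else if k = j then -1 else 0 :: complex)" for k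
    have "(\<Sum>k<Suc (max i j). a k *\<^sub>C z k) = (\<Sum>k\<in>{i,j}. a k *\<^sub>C z k)"
      by (rule sum.mono_neutral_right) (auto simp: a_def)
    also have "\<dots> = 0" using ij by (simp add: a_def)
    finally have "a i = 0" by (rule finite_combination_zero) simp
    then show False by (simp add: a_def)
  qed
  have "complex_vector.independent (range z)"
    unfolding complex_vector.dependent_explicit
  proof (rule notI, elim exE conjE)
    fix t u assume t: "finite t" "t \<subseteq> range z" "(\<Sum>v\<in>t. u v *\<^sub>C v) = 0" and "\<exists>v\<in>t. u v \<noteq> 0"
    then obtain k where k: "z k \<in> t" "u (z k) \<noteq> 0" by blast
    have fin: "finite (z -` t)" using t(1) inj by (simp add: finite_vimageI)
    define n where "n = Suc (Max (z -` t))"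
    have n: "z -` t \<subseteq> {..<n}" using fin unfolding n_def by (auto simp: less_Suc_eq_le)
    define a where "a k = (if z k \<in> t then u (z k) else 0)" for k
    have "(\<Sum>k<n. a k *\<^sub>C z k) = (\<Sum>k\<in>z -` t. a k *\<^sub>C z k)"
      by (rule sum.mono_neutral_right) (use n in \<open>auto simp: a_def\<close>)
    also have "\<dots> = (\<Sum>k\<in>z -` t. u (z k) *\<^sub>C z k)" by (rule sum.cong) (auto simp: a_def)
    also have "\<dots> = (\<Sum>v\<in>z ` (z -` t). u v *\<^sub>C v)"
      using inj by (subst sum.reindex) (auto intro: inj_on_subset)
    also have "z ` (z -` t) = t" using t(2) by blast
    finally have "a k = 0" using t(3) n k by (intro finite_combination_zero[of a n]) auto
    then show False using k by (simp add: a_def)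
  qed
  moreover have "z j \<in> series_space" for j
    unfolding series_space_def
  proof (intro CollectI exI)
    show "(\<lambda>k. (if k = j then 1 else 0) *\<^sub>C z k) sums z j"
      using sums_single[of j z] by (simp add: if_distrib[of "\<lambda>c. c *\<^sub>C _"] cong: if_cong)
  qed
  then have "range z \<subseteq> complex_vector.span B" using B(2) by blast
  ultimately have "finite (range z)" using complex_vector.independent_span_bound[OF B(1)] by blast
  then show False using inj finite_imageD by (metis infinite_UNIV_nat)
qed

end

lemma geometric_tail_bound:
  fixes f :: "nat \<Rightarrow> 'a::banach"
  assumes f: "\<And>k. k \<ge> n \<Longrightarrow> norm (f k) \<le> C * (1/4)^k" and "C \<ge> 0"
  shows "summable f" "norm (\<Sum>k. f (k + n)) \<le> 2 * C * (1/4)^n"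
proof -
  have g: "(\<lambda>k. C * (1/4)^n * (1/4)^k) sums (C * (1/4)^n * (4/3))"
    using sums_mult[OF geometric_sums[of "1/4::real"], of "C * (1/4)^n"] by simp
  have fg: "norm (f (k + n)) \<le> C * (1/4)^n * (1/4)^k" for k
    using f[of "k+n"] by (simp add: power_add mult_ac)
  have "summable (\<lambda>k. f (k + n))"
    by (rule summable_comparison_test'[OF sums_summable[OF g] fg])
  then show "summable f" by simp
  have "norm (\<Sum>k. f (k + n)) \<le> (\<Sum>k. C * (1/4)^n * (1/4)^k)"
    by (rule norm_suminf_le[OF fg sums_summable[OF g]])
  also have "\<dots> = C * (1/4)^n * (4/3)" using g sums_unique by metis
  also have "\<dots> \<le> 2 * C * (1/4)^n" using assms(2) by (simp add: mult_ac mult_left_mono)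
  finally show "norm (\<Sum>k. f (k + n)) \<le> 2 * C * (1/4)^n" .
qed

text \<open>Principle of small perturbations. A coefficient is at most 4 times the norm of the sum
  over \<open>e\<close>, and 4 * (1/32) * 2 = 1/4, so replacing \<open>e\<close> by \<open>z\<close>
  changes partial sums by at most a quarter of that norm. The new constant (2 + 1/4) / (1 - 1/4) = 3
  is rounded up to 4.\<close>

lemma basic_seq_perturb:
  fixes e z :: "nat \<Rightarrow> 'a::complex_banach"
  assumes basis: "\<And>a m n. m \<le> n \<Longrightarrow> norm (\<Sum>k<m. a k *\<^sub>C e k) \<le> 2 * norm (\<Sum>k<n. a k *\<^sub>C e k)"
    and unit: "\<And>k. norm (e k) = 1"
    and close: "\<And>k. norm (z k - e k) \<le> (1/32) * (1/4)^k"
  shows "basic_seq z 4"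
proof
  have e: "basic_seq e 2" using basis unit by unfold_locales (auto, metis norm_zero zero_neq_one)
  fix k show "z k \<noteq> 0"
  proof
    assume "z k = 0"
    then have "1 \<le> (1/32) * (1/4::real)^k" using close[of k] unit[of k] by simp
    moreover have "(1/4::real)^k \<le> 1" by (simp add: power_le_one)
    ultimately show False by simp
  qed
next
  fix a :: "nat \<Rightarrow> complex" and m n :: nat assume mn: "m \<le> n"
  let ?E = "\<lambda>m. norm (\<Sum>k<m. a k *\<^sub>C e k)" and ?Z = "\<lambda>m. norm (\<Sum>k<m. a k *\<^sub>C z k)"
  have coeff: "cmod (a k) \<le> 4 * ?E n" if "k < n" for k
  proof -
    have "cmod (a k) = norm ((\<Sum>k<Suc k. a k *\<^sub>C e k) - (\<Sum>k<k. a k *\<^sub>C e k))" by (simp add: norm_scaleC unit)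
    also have "\<dots> \<le> 2 * ?E n + 2 * ?E n"
      using norm_triangle_ineq4 basis[of "Suc k" n a] basis[of k n a] that by (smt (verit) Suc_leI less_imp_le_nat)
    finally show ?thesis by simp
  qed
  have geo: "(\<Sum>k<n. (1/4::real)^k) \<le> 2"
    using zero_le_power[of "1/4::real" n] by (simp add: sum_gp_strict del: zero_le_power)
  have pert: "norm (\<Sum>k<l. a k *\<^sub>C (z k - e k)) \<le> (1/4) * ?E n" if "l \<le> n" for l
  proof -
    have "norm (\<Sum>k<l. a k *\<^sub>C (z k - e k)) \<le> (\<Sum>k<l. norm (a k *\<^sub>C (z k - e k)))" by (rule norm_sum)
    also have "\<dots> \<le> (\<Sum>k<n. norm (a k *\<^sub>C (z k - e k)))" using that by (intro sum_mono2) auto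
    also have "\<dots> \<le> (\<Sum>k<n. (4 * ?E n) * ((1/32) * (1/4)^k))"
      unfolding norm_scaleC using coeff close by (intro sum_mono mult_mono) auto
    also have "\<dots> = (1/8) * ?E n * (\<Sum>k<n. (1/4)^k)" by (simp add: sum_distrib_left field_simps)
    also have "\<dots> \<le> (1/8) * ?E n * 2" by (intro mult_left_mono geo) auto
    finally show ?thesis by simp
  qed
  have split: "(\<Sum>k<l. a k *\<^sub>C z k) = (\<Sum>k<l. a k *\<^sub>C e k) + (\<Sum>k<l. a k *\<^sub>C (z k - e k))" for l
    by (simp add: complex_vector.scale_right_diff_distrib sum_subtractf)
  have "?Z m \<le> ?E m + (1/4) * ?E n"
    unfolding split using pert[OF mn] norm_triangle_ineq by (meson add_left_mono order_trans)
  also have "\<dots> \<le> (9/4) * ?E n" using basis[OF mn, of a] by simp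
  finally have 1: "?Z m \<le> (9/4) * ?E n" .
  have "?E n \<le> ?Z n + (1/4) * ?E n"
    using split[of n] pert[of n] norm_triangle_ineq4[of "\<Sum>k<n. a k *\<^sub>C z k" "\<Sum>k<n. a k *\<^sub>C (z k - e k)"]
    by simp
  then show "?Z m \<le> 4 * ?Z n" using 1 norm_ge_zero[of "\<Sum>k<n. a k *\<^sub>C z k"] by linarith
qed

section \<open>Expanding powers exclude hypercyclic subspaces\<close>

text \<open>A fixed choice for each set, so that the recursive constructions can name the subspace
  in their conditions. It meets the span of \<open>B\<close> only in 0, but need not be an algebraic
  complement.\<close>

definition ortho_compl :: "'a::complex_banach set \<Rightarrow> 'a set"
  where "ortho_compl B = (SOME L. L \<in> cofin \<and> (\<forall>y\<in>complex_vector.span B. \<forall>z\<in>L. norm y \<le> 2 * norm (y + z)))"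

lemma ortho_compl:
  assumes "finite B"
  shows "ortho_compl B \<in> cofin"
    and "\<And>y z. y \<in> complex_vector.span B \<Longrightarrow> z \<in> ortho_compl B \<Longrightarrow> norm y \<le> 2 * norm (y + z)"
  using someI_ex[of "\<lambda>L. L \<in> cofin \<and> (\<forall>y\<in>complex_vector.span B. \<forall>z\<in>L. norm y \<le> 2 * norm (y + z))"]
    almost_orthogonal_cofin[OF assms] unfolding ortho_compl_def by blast+

text \<open>The whole tail from \<open>i\<close> on lies in one subspace, so the factor 2 does not
  accumulate. Only one index \<open>i\<close> occurs, because along the orbit at time m the
  hypothesis will hold only from an index depending on m.\<close>

lemma ortho_partial_sums:
  fixes u :: "nat \<Rightarrow> 'a::complex_banach"
  assumes u: "\<And>j. i \<le> j \<Longrightarrow> u j \<in> ortho_compl (u ` {..<i})" and "i \<le> n"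
  shows "norm (\<Sum>k<i. a k *\<^sub>C u k) \<le> 2 * norm (\<Sum>k<n. a k *\<^sub>C u k)"
proof -
  note sub = cofin_subspace[OF ortho_compl(1)[of "u ` {..<i}"]]
  have "(\<Sum>k<i. a k *\<^sub>C u k) \<in> complex_vector.span (u ` {..<i})"
    by (intro complex_vector.span_sum complex_vector.span_scale complex_vector.span_base) auto
  moreover have "(\<Sum>k=i..<n. a k *\<^sub>C u k) \<in> ortho_compl (u ` {..<i})"
    using u by (intro complex_vector.subspace_sum complex_vector.subspace_scale sub) auto
  moreover have "(\<Sum>k<i. a k *\<^sub>C u k) + (\<Sum>k=i..<n. a k *\<^sub>C u k) = (\<Sum>k<n. a k *\<^sub>C u k)"
    using \<open>i \<le> n\<close> by (metis atLeast0LessThan le0 sum.atLeastLessThan_concat)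
  ultimately show ?thesis using ortho_compl(2)[of "u ` {..<i}"] by fastforce
qed

section \<open>Bounded operators, their powers, and uniform growth\<close>

locale bounded_operator =
  fixes T :: "'a::complex_banach \<Rightarrow> 'a"
  assumes linear: "Vector_Spaces.linear (*\<^sub>C) (*\<^sub>C) T"
    and cont: "continuous_on UNIV T"
begin

lemma pow_linear: "Vector_Spaces.linear (*\<^sub>C) (*\<^sub>C) (T ^^ n)"
proof (induction n)
  case 0
  show ?case using complex_vector.linear_id by (simp add: id_def)
next
  case (Suc n)
  then show ?case using Vector_Spaces.linear_compose[OF Suc linear] by (simp add: o_def)
qed

lemma pow_add: "(T ^^ n) (x + y) = (T ^^ n) x + (T ^^ n) y"
  and pow_scale: "(T ^^ n) (c *\<^sub>C x) = c *\<^sub>C (T ^^ n) x"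
  and pow_zero: "(T ^^ n) 0 = 0"
  and pow_diff: "(T ^^ n) (x - y) = (T ^^ n) x - (T ^^ n) y"
  and pow_sum: "(T ^^ n) (\<Sum>i\<in>I. f i) = (\<Sum>i\<in>I. (T ^^ n) (f i))"
proof -
  interpret P: Vector_Spaces.linear "(*\<^sub>C)" "(*\<^sub>C)" "T ^^ n" by (rule pow_linear)
  show "(T ^^ n) (x + y) = (T ^^ n) x + (T ^^ n) y" by (rule P.add)
  show "(T ^^ n) (c *\<^sub>C x) = c *\<^sub>C (T ^^ n) x" by (rule P.scale)
  show "(T ^^ n) 0 = 0" by (rule P.zero)
  show "(T ^^ n) (x - y) = (T ^^ n) x - (T ^^ n) y" by (rule P.diff)
  show "(T ^^ n) (\<Sum>i\<in>I. f i) = (\<Sum>i\<in>I. (T ^^ n) (f i))" by (rule P.sum)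
qed

lemma bounded: obtains B where "B \<ge> 1" "\<And>x. norm (T x) \<le> B * norm x"
proof -
  have "isCont T 0" using cont by (simp add: continuous_on_eq_continuous_at)
  then obtain d where d: "d > 0" "\<And>x. norm x < d \<Longrightarrow> norm (T x) < 1"
    using pow_zero[of 1] unfolding continuous_at_eps_delta
    by (auto dest!: spec[of _ 1])
  have "norm (T x) \<le> (2 / d) * norm x" for x
  proof (cases "x = 0")
    case False
    define c where "c = complex_of_real (d / (2 * norm x))"
    have "norm (T (c *\<^sub>C x)) < 1"
      using d(1) False by (intro d) (simp add: c_def norm_scaleC norm_divide norm_mult)
    then have "d / (2 * norm x) * norm (T x) < 1"
      using pow_scale[of 1 c x] d(1) by (simp add: c_def norm_scaleC norm_divide norm_mult)
    then show ?thesis using False d(1) by (simp add: field_simps)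
  qed (use pow_zero[of 1] in simp)
  then have "norm (T x) \<le> max 1 (2 / d) * norm x" for x
    by (meson max.cobounded2 mult_right_mono norm_ge_zero order_trans)
  then show ?thesis using that[of "max 1 (2/d)"] by auto
qed

lemma pow_bound:
  assumes "B \<ge> 0" "\<And>x. norm (T x) \<le> B * norm x" shows "norm ((T ^^ n) x) \<le> B ^ n * norm x"
proof (induction n)
  case (Suc n)
  have "norm ((T ^^ Suc n) x) \<le> B * norm ((T ^^ n) x)" using assms(2) by simp
  also have "\<dots> \<le> B * (B ^ n * norm x)" using Suc assms(1) by (intro mult_left_mono)
  finally show ?case by (simp add: mult_ac)
qed simp

lemma pow_bounded_linear: "bounded_linear (T ^^ n)"
proof -
  obtain B where B: "B \<ge> 1" "\<And>x. norm (T x) \<le> B * norm x" using bounded by metis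
  show ?thesis
    using pow_bound[OF _ B(2), of n] B(1)
    by (intro bounded_linear_intro[of _ "B ^ n"])
      (auto simp: pow_add pow_scale scaleC_of_real[symmetric] mult.commute)
qed

lemma cofin_pow_vimage: "E \<in> cofin \<Longrightarrow> (T ^^ n) -` E \<in> cofin"
  using cofin_vimage[OF pow_linear] .

lemma cofin_orbit: "E \<in> cofin \<Longrightarrow> (\<Inter>i\<in>{..n}. (T ^^ i) -` E) \<in> cofin"
  by (intro cofin_INT cofin_pow_vimage) auto

text \<open>Expansion can be iterated as long as the orbit visits \<open>E\<close> at multiples of
  \<open>n\<close>, a condition of finite codimension for each fixed length. The constants
  \<open>d\<close> and \<open>R\<close> do not depend on \<open>m\<close>; only the subspace
  does.\<close>

lemma expanding_growth:
  assumes n: "n \<ge> 1" and E: "E \<in> cofin" and C: "C > 1"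
    and expand: "\<And>x. x \<in> E \<Longrightarrow> C * norm x \<le> norm ((T ^^ n) x)"
  obtains d R where "d \<ge> 1" "R > 0"
    "\<And>m. \<exists>F\<in>cofin. \<forall>x\<in>F. R * 2 ^ (m div d) * norm x \<le> norm ((T ^^ m) x)"
proof -
  obtain B where B: "B \<ge> 1" "\<And>x. norm (T x) \<le> B * norm x" using bounded by metis
  obtain p' where p': "2 < C ^ p'" using real_arch_pow[OF C] by blast
  then obtain p where p: "2 \<le> C ^ p" "p \<ge> 1" by (cases p') (auto intro!: that[of p'] simp del: power_Suc)
  define d where "d = n * p"
  define R where "R = 1 / B ^ d"
  have "\<exists>F\<in>cofin. \<forall>x\<in>F. R * 2 ^ (m div d) * norm x \<le> norm ((T ^^ m) x)" for m
  proof -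
    \<comment> \<open>The time n q is the first multiple of \<open>d\<close> beyond
      \<open>m\<close>. It overshoots \<open>m\<close> by at most \<open>d\<close>, which costs at
      most the factor B^d in the norm and explains \<open>R\<close>.\<close>
    define q where "q = (m div d + 1) * p"
    define F where "F = (\<Inter>i\<in>{..n * q}. (T ^^ i) -` E)"
    have F: "F \<in> cofin" unfolding F_def using E by (rule cofin_orbit)
    have "R * 2 ^ (m div d) * norm x \<le> norm ((T ^^ m) x)" if x: "x \<in> F" for x
    proof -
      have "C ^ j * norm x \<le> norm ((T ^^ (n * j)) x)" if "j \<le> q" for j
        using that
      proof (induction j)
        case (Suc j)
        have "n * j \<le> n * q" using Suc.prems by simp
        then have "(T ^^ (n * j)) x \<in> E" using x unfolding F_def by blast
        then have "C * norm ((T ^^ (n * j)) x) \<le> norm ((T ^^ (n * Suc j)) x)"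
          using expand[of "(T ^^ (n * j)) x"] by (simp add: funpow_add)
        moreover have "C * (C ^ j * norm x) \<le> C * norm ((T ^^ (n * j)) x)"
          using Suc C by (intro mult_left_mono) auto
        ultimately show ?case by (simp add: mult_ac)
      qed simp
      then have 1: "C ^ q * norm x \<le> norm ((T ^^ (n * q)) x)" by simp
      have nq: "n * q = d * (m div d) + d" by (simp add: q_def d_def algebra_simps)
      have "m \<le> n * q" unfolding nq using n p(2)
        by (metis add_left_mono d_def less_imp_le_nat mod_less_divisor mult_div_mod_eq nat_0_less_mult_iff zero_less_one less_le_trans)
      moreover have "n * q - m \<le> d" unfolding nq using times_div_less_eq_dividend[of d m] by linarith
      ultimately obtain r where r: "n * q = r + m" "r \<le> d" by (metis le_add_diff_inverse2)
      have "norm ((T ^^ (n * q)) x) \<le> B ^ r * norm ((T ^^ m) x)"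
        using pow_bound[OF _ B(2), of r "(T ^^ m) x"] B(1) by (simp add: r(1) funpow_add)
      also have "\<dots> \<le> B ^ d * norm ((T ^^ m) x)" using r(2) B(1) by (intro mult_right_mono power_increasing) auto
      finally have 2: "norm ((T ^^ (n * q)) x) \<le> B ^ d * norm ((T ^^ m) x)" .
      have "2 ^ (m div d) \<le> (2::real) ^ (m div d + 1)" by simp
      also have "\<dots> \<le> (C ^ p) ^ (m div d + 1)" using p(1) by (intro power_mono) auto
      also have "\<dots> = C ^ q" by (simp only: q_def power_mult[symmetric] mult.commute)
      finally have "2 ^ (m div d) * norm x \<le> B ^ d * norm ((T ^^ m) x)"
        using 1 2 by (meson mult_right_mono norm_ge_zero order_trans)
      moreover have "B ^ d > 0" using B(1) by simp
      ultimately show ?thesis by (simp add: R_def field_simps)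
    qed
    then show ?thesis using F by blast
  qed
  moreover have "d \<ge> 1" "R > 0" using n p(2) B(1) by (auto simp: d_def R_def)
  ultimately show ?thesis using that by blast
qed

lemma expanding_no_hypercyclic_subspace:
  assumes n: "n \<ge> 1" and E: "E \<in> cofin" and C: "C > 1"
    and expand: "\<And>x. x \<in> E \<Longrightarrow> C * norm x \<le> norm ((T ^^ n) x)"
  shows "\<not> hypercyclic_subspace T M"
proof
  assume "hypercyclic_subspace T M"
  then have M: "complex_vector.subspace M" "closed M" "\<nexists>B. finite B \<and> complex_vector.span B = M"
    and hc: "\<And>x. x \<in> M \<Longrightarrow> x \<noteq> 0 \<Longrightarrow> hypercyclic_vector T x"
    by (auto simp: hypercyclic_subspace_def)
  obtain d R F where d: "d \<ge> 1" and R: "R > 0" and F: "\<And>m. F m \<in> cofin"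
    and growth: "\<And>m x. x \<in> F m \<Longrightarrow> R * 2 ^ (m div d) * norm x \<le> norm ((T ^^ m) x)"
    using expanding_growth[OF n E C expand] by metis
  \<comment> \<open>The vector with index \<open>j\<close> is prepared for the times below d (j + 1)
    only, which is a finite list of conditions of finite codimension.\<close>
  define P where "P f j r \<longleftrightarrow> norm r = 1 \<and> r \<in> M \<and> (\<forall>m<d * (j + 1). r \<in> F m \<and>
      (\<forall>i\<le>j. (T ^^ m) r \<in> ortho_compl ((\<lambda>k. (T ^^ m) (f k)) ` {..<i})))"
    for f :: "nat \<Rightarrow> 'a" and j :: nat and r :: 'a
  have "\<exists>e. \<forall>j. P e j (e j)"
  proof (rule dependent_wellorder_choice)
    fix r and f g :: "nat \<Rightarrow> 'a" and j :: nat
    assume fg: "\<And>k. k < j \<Longrightarrow> f k = g k"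
    have "(\<lambda>k. (T ^^ m) (f k)) ` {..<i} = (\<lambda>k. (T ^^ m) (g k)) ` {..<i}" if "i \<le> j" for m i
      using fg that by (intro image_cong) auto
    then show "P f j r = P g j r" unfolding P_def by simp
  next
    fix j and f :: "nat \<Rightarrow> 'a"
    let ?L = "\<lambda>m i. (T ^^ m) -` ortho_compl ((\<lambda>k. (T ^^ m) (f k)) ` {..<i})"
    have "(\<Inter>m\<in>{..<d * (j + 1)}. F m \<inter> (\<Inter>i\<in>{..j}. ?L m i)) \<in> cofin"
      by (intro cofin_INT cofin_Int F cofin_pow_vimage ortho_compl(1)) auto
    from cofin_inter_infinite_dim[OF this M(1,3)] show "\<exists>r. P f j r" unfolding P_def by auto
  qed
  then obtain e where "\<And>j. P e j (e j)" by blast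
  then have e: "norm (e j) = 1" "e j \<in> M" "m < d * (j + 1) \<Longrightarrow> e j \<in> F m"
    "m < d * (j + 1) \<Longrightarrow> i \<le> j \<Longrightarrow> (T ^^ m) (e j) \<in> ortho_compl ((\<lambda>k. (T ^^ m) (e k)) ` {..<i})" for j m i
    unfolding P_def by blast+
  define x where "x = (\<Sum>k. (1/2) ^ k *\<^sub>C e k)"
  have "summable (\<lambda>k. (1/2) ^ k *\<^sub>C e k)"
    by (rule summable_comparison_test'[of "\<lambda>k. (1/2::real)^k" 0])
      (auto simp: norm_scaleC norm_power norm_divide e(1))
  then have x: "(\<lambda>k. (1/2) ^ k *\<^sub>C e k) sums x" unfolding x_def by (rule summable_sums)
  have "x \<in> M"
    using x unfolding sums_def
  proof (rule closed_sequentially[OF M(2), rotated])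
    show "(\<Sum>k<n. (1/2) ^ k *\<^sub>C e k) \<in> M" for n
      using e(2) M(1) by (intro complex_vector.subspace_sum complex_vector.subspace_scale) auto
  qed
  \<comment> \<open>At time \<open>m\<close> the term with index k = m div d is decisive: its weight
    2^(-k) cancels the growth 2^k and leaves at least R. It is the difference of two partial sums,
    each of norm at most twice that of T^m x; hence R / 4.\<close>
  have low: "R / 4 \<le> norm ((T ^^ m) x)" for m
  proof -
    define k where "k = m div d"
    have mk: "m < d * (k + 1)" using d unfolding k_def
      by (metis Suc_eq_plus1 dividend_less_times_div less_le_trans mult.commute mult_Suc_right zero_less_one add.commute)
    have Tx: "(\<lambda>k. (1/2) ^ k *\<^sub>C (T ^^ m) (e k)) sums ((T ^^ m) x)"
      using bounded_linear.sums[OF pow_bounded_linear x, of m] by (simp add: pow_scale)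
    have part: "norm (\<Sum>l<i. (1/2) ^ l *\<^sub>C (T ^^ m) (e l)) \<le> 2 * norm ((T ^^ m) x)" if i: "k \<le> i" for i
    proof (rule LIMSEQ_le_const)
      show "(\<lambda>n. 2 * norm (\<Sum>l<n. (1/2) ^ l *\<^sub>C (T ^^ m) (e l))) \<longlonglongrightarrow> 2 * norm ((T ^^ m) x)"
        using Tx unfolding sums_def by (intro tendsto_intros)
      have "(T ^^ m) (e j) \<in> ortho_compl ((\<lambda>k. (T ^^ m) (e k)) ` {..<i})" if "i \<le> j" for j
      proof (rule e(4)[OF _ that])
        have "d * (k + 1) \<le> d * (j + 1)" using i that by simp
        then show "m < d * (j + 1)" using mk by linarith
      qed
      from ortho_partial_sums[of i "\<lambda>j. (T ^^ m) (e j)", OF this]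
      show "\<exists>N. \<forall>n\<ge>N. norm (\<Sum>l<i. (1/2) ^ l *\<^sub>C (T ^^ m) (e l)) \<le> 2 * norm (\<Sum>l<n. (1/2) ^ l *\<^sub>C (T ^^ m) (e l))"
        by blast
    qed
    have "R * 2 ^ k \<le> norm ((T ^^ m) (e k))" using growth[OF e(3)[OF mk]] e(1) by (simp add: k_def)
    then have "R \<le> norm ((1/2) ^ k *\<^sub>C (T ^^ m) (e k))"
      by (simp add: norm_scaleC norm_power norm_divide field_simps)
    also have "(1/2) ^ k *\<^sub>C (T ^^ m) (e k) =
        (\<Sum>l<Suc k. (1/2) ^ l *\<^sub>C (T ^^ m) (e l)) - (\<Sum>l<k. (1/2) ^ l *\<^sub>C (T ^^ m) (e l))" by simp
    also have "norm \<dots> \<le> 2 * norm ((T ^^ m) x) + 2 * norm ((T ^^ m) x)"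
      by (intro order_trans[OF norm_triangle_ineq4] add_mono part) auto
    finally show ?thesis by simp
  qed
  have "x \<noteq> 0" using low[of 0] R by auto
  then have "0 \<in> closure {(T ^^ n) x | n. n \<ge> 1}"
    using hc[OF \<open>x \<in> M\<close>] by (simp add: hypercyclic_vector_def)
  moreover have "R / 4 > 0" using R by simp
  ultimately obtain y where y: "y \<in> {(T ^^ n) x | n. n \<ge> 1}" "dist y 0 < R / 4"
    unfolding closure_approachable by meson
  then obtain m where "y = (T ^^ m) x" by blast
  then show False using y(2) low[of m] by simp
qed

end

section \<open>Approximate eigenvalues modulo finite codimension\<close>

text \<open>Fourier inversion over the roots of unity of order n + 1, which are enough to separate
  the n + 1 coefficients and lose no constant.\<close>

lemma trig_sum_coeff_bound:
  fixes y :: "nat \<Rightarrow> 'a::complex_banach"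
  assumes V: "\<And>\<zeta>. cmod \<zeta> = 1 \<Longrightarrow> norm (\<Sum>j\<le>n. \<zeta> ^ j *\<^sub>C y j) \<le> V" and i: "i \<le> n"
  shows "norm (y i) \<le> V"
proof -
  define N where "N = Suc n"
  define \<omega> where "\<omega> m = exp (2 * of_real pi * \<i> * of_nat m / of_nat N)" for m :: nat
  have \<omega>pow: "\<omega> m ^ l = \<omega> (m * l)" for m l
    unfolding \<omega>_def exp_of_nat_mult[symmetric] by (simp add: field_simps)
  have \<omega>N: "\<omega> m ^ N = 1" for m unfolding \<omega>_def by (rule complex_root_unity) (simp add: N_def)
  have \<omega>1: "\<omega> m = 1 \<longleftrightarrow> N dvd m" for m unfolding \<omega>_def by (rule complex_root_unity_eq_1) (simp add: N_def)
  have \<omega>norm: "cmod (\<omega> m) = 1" for m unfolding \<omega>_def by (simp add: norm_exp_eq_Re)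
  have \<omega>mult: "\<omega> a * \<omega> b = \<omega> (a + b)" for a b
    unfolding \<omega>_def exp_add[symmetric] by (simp add: add_divide_distrib algebra_simps)
  have orth: "(\<Sum>l<N. \<omega> m ^ l) = (if N dvd m then of_nat N else 0)" for m
    using \<omega>N[of m] \<omega>1[of m] geometric_sum[of "\<omega> m" N] by auto
  \<comment> \<open>The exponent N - i stands for -i in the natural numbers. As N - i + j lies
    strictly between 0 and 2 N, the only multiple of N in reach is N itself.\<close>
  have dvd: "N dvd (N - i + j) \<longleftrightarrow> j = i" if "j \<le> n" for j
  proof
    assume "N dvd (N - i + j)"
    then obtain k where k: "N - i + j = N * k" by (auto elim: dvdE)
    have "0 < N * k" "N * k < N * 2" using k that i by (auto simp: N_def)
    then have "k = 1" by auto
    then show "j = i" using k i by (simp add: N_def)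
  qed (use i in \<open>simp add: N_def\<close>)
  have "(\<Sum>l<N. \<omega> l ^ (N - i) *\<^sub>C (\<Sum>j\<le>n. \<omega> l ^ j *\<^sub>C y j)) = (\<Sum>l<N. \<Sum>j\<le>n. (\<omega> (N - i + j) ^ l) *\<^sub>C y j)"
    by (simp add: complex_vector.scale_sum_right \<omega>pow \<omega>mult algebra_simps)
  also have "\<dots> = (\<Sum>j\<le>n. (\<Sum>l<N. \<omega> (N - i + j) ^ l) *\<^sub>C y j)"
    by (subst sum.swap) (simp add: complex_vector.scale_sum_left)
  also have "\<dots> = (\<Sum>j\<le>n. (if j = i then of_nat N else 0) *\<^sub>C y j)"
    by (intro sum.cong refl) (simp add: orth dvd)
  also have "\<dots> = of_nat N *\<^sub>C y i"
    using i by (simp add: if_distrib[of "\<lambda>c. c *\<^sub>C _"] cong: if_cong)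
  finally have "real N * norm (y i) = norm (\<Sum>l<N. \<omega> l ^ (N - i) *\<^sub>C (\<Sum>j\<le>n. \<omega> l ^ j *\<^sub>C y j))"
    by (simp add: norm_scaleC)
  also have "\<dots> \<le> (\<Sum>l<N. V)"
    using V[OF \<omega>norm] by (intro sum_norm_le) (simp add: norm_scaleC norm_power \<omega>norm)
  also have "\<dots> = real N * V" by simp
  finally show ?thesis by (simp add: N_def)
qed

section \<open>Powers of 1 + X + ... + X^(q-1), and polynomials of an operator\<close>

definition geom_poly :: "nat \<Rightarrow> complex poly"
  where "geom_poly q = (\<Sum>i<q. monom 1 i)"

lemma geom_poly_mult: "[:-1, 1:] * geom_poly q = monom 1 q - 1"
proof (induction q)
  case (Suc q)
  have "[:-1, 1:] * monom 1 q = monom 1 (Suc q) - (monom 1 q :: complex poly)"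
    by (simp add: monom_Suc)
  with Suc show ?case by (simp add: geom_poly_def algebra_simps)
qed (simp add: geom_poly_def)

lemma degree_geom_poly_power: "degree (geom_poly q ^ k) \<le> k * q"
proof -
  have "degree (geom_poly q) \<le> q"
    unfolding geom_poly_def by (rule degree_sum_le) (auto intro: order_trans[OF degree_monom_le])
  then have "k * degree (geom_poly q) \<le> k * q" by (rule mult_le_mono2)
  then show ?thesis using degree_power_le[of "geom_poly q" k] by (metis mult.commute order_trans)
qed

text \<open>Evaluation at 1. This total mass is what bounds on the single coefficients will
  contradict.\<close>

lemma sum_coeff_geom_poly_power:
  assumes "k * q \<le> n" shows "real q ^ k \<le> (\<Sum>i\<le>n. cmod (coeff (geom_poly q ^ k) i))"
proof -
  have "degree (geom_poly q ^ k) \<le> n" using degree_geom_poly_power[of q k] assms by simp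
  then have "poly (geom_poly q ^ k) 1 = (\<Sum>i\<le>n. coeff (geom_poly q ^ k) i)"
    by (simp add: poly_altdef) (rule sum.mono_neutral_left, auto simp: coeff_eq_0)
  moreover have "poly (geom_poly q ^ k) 1 = of_nat q ^ k"
    by (simp add: geom_poly_def poly_sum poly_monom)
  ultimately have "of_nat q ^ k = (\<Sum>i\<le>n. coeff (geom_poly q ^ k) i)" by simp
  then have "real q ^ k = cmod (\<Sum>i\<le>n. coeff (geom_poly q ^ k) i)" by (metis norm_of_nat norm_power)
  then show ?thesis using norm_sum by metis
qed

context bounded_operator
begin

definition poly_op :: "complex poly \<Rightarrow> 'a \<Rightarrow> 'a"
  where "poly_op p x = (\<Sum>i\<le>degree p. coeff p i *\<^sub>C (T ^^ i) x)"

lemma poly_op_eq: "degree p \<le> n \<Longrightarrow> poly_op p x = (\<Sum>i\<le>n. coeff p i *\<^sub>C (T ^^ i) x)"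
  unfolding poly_op_def by (rule sum.mono_neutral_left) (auto simp: coeff_eq_0)

lemma poly_op_pCons: "poly_op (pCons a p) x = a *\<^sub>C x + T (poly_op p x)"
proof -
  have "poly_op (pCons a p) x = (\<Sum>i\<le>Suc (degree p). coeff (pCons a p) i *\<^sub>C (T ^^ i) x)"
    by (rule poly_op_eq) (simp add: degree_pCons_le)
  also have "\<dots> = a *\<^sub>C x + T (poly_op p x)"
    unfolding sum.atMost_Suc_shift poly_op_def by (simp add: pow_sum[of 1, simplified] pow_scale[of 1, simplified])
  finally show ?thesis .
qed

lemma poly_op_0: "poly_op 0 x = 0" and poly_op_1: "poly_op 1 x = x"
  by (auto simp: poly_op_def)

lemma poly_op_add: "poly_op (p + q) x = poly_op p x + poly_op q x"
proof -
  let ?n = "max (degree p) (degree q)"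
  show ?thesis
    using poly_op_eq[of "p+q" ?n x] poly_op_eq[of p ?n x] poly_op_eq[of q ?n x] degree_add_le_max[of p q]
    by (simp add: scaleC_add_left sum.distrib)
qed

lemma poly_op_smult: "poly_op (smult a p) x = a *\<^sub>C poly_op p x"
  using poly_op_eq[OF degree_smult_le, of a p x] by (simp add: poly_op_def complex_vector.scale_sum_right)

lemma poly_op_mult: "poly_op (p * q) x = poly_op p (poly_op q x)"
proof (induction p)
  case (pCons a p)
  then show ?case using pow_zero[of 1] by (simp add: mult_pCons_left poly_op_add poly_op_smult poly_op_pCons poly_op_0)
qed (simp add: poly_op_0)

lemma poly_op_vec_diff: "poly_op p (x - y) = poly_op p x - poly_op p y"
  by (simp add: poly_op_def pow_diff complex_vector.scale_right_diff_distrib sum_subtractf)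

lemma poly_op_monom_diff_1: "poly_op (monom 1 q - 1) x = (T ^^ q) x - x"
proof -
  have "poly_op (monom 1 q) x = (T ^^ q) x"
    by (subst poly_op_eq[of _ q]) (auto simp: degree_monom_le if_distrib[of "\<lambda>c. c *\<^sub>C _"] cong: if_cong)
  moreover have "poly_op (monom 1 q) x = poly_op (monom 1 q - 1) x + poly_op 1 x"
    using poly_op_add[of "monom 1 q - 1" 1 x] by simp
  ultimately show ?thesis by (simp add: poly_op_1 eq_diff_eq)
qed

lemma poly_op_mem:
  assumes "complex_vector.subspace E" "degree p \<le> n" "\<And>i. i \<le> n \<Longrightarrow> (T ^^ i) x \<in> E"
  shows "poly_op p x \<in> E"
  unfolding poly_op_eq[OF assms(2)]
  using assms by (intro complex_vector.subspace_sum complex_vector.subspace_scale) auto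

text \<open>Each factor T^q - 1 doubles the number of terms, so 2^k iterates occur in all.\<close>

lemma poly_op_upper:
  assumes "\<And>i. i \<le> k \<Longrightarrow> norm ((T ^^ (q * i)) x) \<le> D"
  shows "norm (poly_op ((monom 1 q - 1) ^ k) x) \<le> 2 ^ k * D"
  using assms
proof (induction k arbitrary: x)
  case (Suc k)
  have "poly_op ((monom 1 q - 1) ^ Suc k) x = poly_op ((monom 1 q - 1) ^ k) ((T ^^ q) x) - poly_op ((monom 1 q - 1) ^ k) x"
    unfolding power_Suc2 poly_op_mult poly_op_monom_diff_1 poly_op_vec_diff ..
  moreover have "norm (poly_op ((monom 1 q - 1) ^ k) ((T ^^ q) x)) \<le> 2 ^ k * D"
  proof (rule Suc.IH)
    fix i assume "i \<le> k"
    then show "norm ((T ^^ (q * i)) ((T ^^ q) x)) \<le> D"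
      using Suc.prems[of "Suc i"] by (simp add: funpow_add add.commute[of q])
  qed
  moreover have "norm (poly_op ((monom 1 q - 1) ^ k) x) \<le> 2 ^ k * D"
    using Suc.prems by (intro Suc.IH) auto
  ultimately show ?case
    using norm_triangle_ineq4[of "poly_op ((monom 1 q - 1) ^ k) ((T ^^ q) x)" "poly_op ((monom 1 q - 1) ^ k) x"]
    by simp
qed (simp add: poly_op_1)

text \<open>Since $(X-1)^k G^k = (X^q-1)^k$ for $G = 1 + X + \dots + X^{q-1}$, an operator for which
  $T-1$ is bounded below by $c$ gains a factor $c$ from each of the $k$ factors $X-1$.\<close>

lemma poly_op_geom_bound:
  assumes E: "complex_vector.subspace E" and c: "c \<ge> 0" and below: "\<And>y. y \<in> E \<Longrightarrow> c * norm y \<le> norm (T y - y)"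
    and x: "\<And>i. i \<le> k * (q + 1) \<Longrightarrow> (T ^^ i) x \<in> E" and D: "\<And>i. i \<le> k * (q + 1) \<Longrightarrow> norm ((T ^^ i) x) \<le> D"
  shows "c ^ k * norm (poly_op (geom_poly q ^ k) x) \<le> 2 ^ k * D"
proof -
  have "c ^ j * norm (poly_op (geom_poly q ^ k) x) \<le> norm (poly_op ([:-1, 1:] ^ j * geom_poly q ^ k) x)" if "j \<le> k" for j
    using that
  proof (induction j)
    case (Suc j)
    let ?y = "poly_op ([:-1, 1:] ^ j * geom_poly q ^ k) x"
    have "degree ([:-1, 1::complex:] ^ j * geom_poly q ^ k) \<le> degree ([:-1, 1::complex:] ^ j) + degree (geom_poly q ^ k)"
      by (rule degree_mult_le)
    also have "\<dots> \<le> j + k * q"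
      using degree_power_le[of "[:-1, 1::complex:]" j] degree_geom_poly_power[of q k] by simp
    also have "\<dots> \<le> k * (q + 1)" using Suc.prems by simp
    finally have "?y \<in> E" using x by (rule poly_op_mem[OF E])
    have "c ^ Suc j * norm (poly_op (geom_poly q ^ k) x) \<le> c * norm ?y"
      using Suc c by (simp add: mult_left_mono mult.assoc)
    also have "\<dots> \<le> norm (T ?y - ?y)" using below \<open>?y \<in> E\<close> by blast
    also have "T ?y - ?y = poly_op ([:-1, 1:] ^ Suc j * geom_poly q ^ k) x"
      using pow_zero[of 1]
      by (simp only: power_Suc mult.assoc poly_op_mult[of "[:-1,1:]"])
        (simp add: poly_op_pCons poly_op_0)
    finally show ?case .
  qed simp
  from this[of k] have "c ^ k * norm (poly_op (geom_poly q ^ k) x) \<le> norm (poly_op ((monom 1 q - 1) ^ k) x)"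
    by (simp only: power_mult_distrib[symmetric] geom_poly_mult)
  also have "\<dots> \<le> 2 ^ k * D"
  proof (rule poly_op_upper)
    fix i assume "i \<le> k"
    then have "q * i \<le> k * (q + 1)" by (metis le_add1 mult.commute mult_le_mono)
    then show "norm ((T ^^ (q * i)) x) \<le> D" by (rule D)
  qed
  finally show ?thesis .
qed

text \<open>Up to the endpoint, these \<open>c\<close> are the numbers below the inner supremum over
  \<open>cofin\<close> in the theorem, for the exponent \<open>n\<close>.\<close>

definition ess_below :: "nat \<Rightarrow> real \<Rightarrow> bool"
  where "ess_below n c \<longleftrightarrow> (\<exists>E\<in>cofin. \<forall>x\<in>E. c * norm x \<le> norm ((T ^^ n) x))"

lemma ess_below_0: "ess_below 0 1"
  unfolding ess_below_def using cofin_UNIV by auto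

lemma ess_below_mono: "ess_below n c \<Longrightarrow> c' \<le> c \<Longrightarrow> ess_below n c'"
  unfolding ess_below_def by (meson mult_right_mono norm_ge_zero order_trans)

lemma ess_below_mult:
  assumes "ess_below m c" "ess_below n d" "d \<ge> 0" shows "ess_below (m + n) (c * d)"
proof -
  obtain E F where EF: "E \<in> cofin" "F \<in> cofin" "\<And>x. x \<in> E \<Longrightarrow> c * norm x \<le> norm ((T ^^ m) x)"
    "\<And>x. x \<in> F \<Longrightarrow> d * norm x \<le> norm ((T ^^ n) x)"
    using assms unfolding ess_below_def by blast
  have "c * d * norm x \<le> norm ((T ^^ (m + n)) x)" if "x \<in> E \<inter> (T ^^ m) -` F" for x
  proof -
    have "c * d * norm x \<le> d * norm ((T ^^ m) x)" using mult_left_mono[OF EF(3) assms(3), of x] that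
      by (simp add: mult_ac)
    also have "\<dots> \<le> norm ((T ^^ n) ((T ^^ m) x))" using EF(4) that by simp
    finally show ?thesis by (simp add: add.commute[of m] funpow_add)
  qed
  then show ?thesis unfolding ess_below_def
    using cofin_Int[OF EF(1) cofin_pow_vimage[OF EF(2)]] by blast
qed

lemma ess_below_power: "ess_below n c \<Longrightarrow> c \<ge> 0 \<Longrightarrow> ess_below (n * k) (c ^ k)"
proof (induction k)
  case (Suc k)
  then show ?case using ess_below_mult[of n c "n * k" "c ^ k"] by simp
qed (simp add: ess_below_0)

text \<open>The radius \<open>t\<close> is the exponential growth rate of the best lower bounds of the powers of \<open>T\<close>
  modulo finite codimension. The lower bounds propagate along any orbit of length \<open>n\<close> that
  almost attains the optimal rate at time \<open>n\<close>, and control its norm from both sides at all times.\<close>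

lemma balanced_orbits:
  assumes \<delta>: "\<delta> > 0" "ess_below 1 \<delta>" and C: "\<And>n c. n \<ge> 1 \<Longrightarrow> ess_below n c \<Longrightarrow> c \<le> C"
  obtains t where "0 < t" "t \<le> 1"
    "\<And>\<rho>. \<rho> > 1 \<Longrightarrow> \<exists>K>0. \<forall>n\<ge>1. \<forall>E\<in>cofin. \<exists>x. \<forall>i\<le>n. (T ^^ i) x \<in> E \<and>
        K / \<rho> ^ n * t ^ i \<le> norm ((T ^^ i) x) \<and> norm ((T ^^ i) x) \<le> \<rho> ^ n / K * t ^ i"
proof -
  \<comment> \<open>The exponential rates at which all powers are bounded below modulo finite
    codimension, up to a constant; \<delta> is one of them, and a rate above 1 would exceed
    \<open>C\<close>.\<close>
  define A where "A = {s. s > 0 \<and> (\<exists>K>0. \<forall>n. ess_below n (K * s ^ n))}"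
  have \<delta>A: "\<delta> \<in> A" unfolding A_def using \<delta>(1) ess_below_power[OF \<delta>(2)] by (auto intro!: exI[of _ 1])
  have A1: "s \<le> 1" if sA: "s \<in> A" for s
  proof (rule ccontr)
    assume s: "\<not> s \<le> 1"
    obtain K where K: "K > 0" "\<And>n. ess_below n (K * s ^ n)" using sA by (auto simp: A_def)
    obtain n where "C / K < s ^ n" using s real_arch_pow[of s "C/K"] by auto
    also have "\<dots> \<le> s ^ Suc n" using s by (intro power_increasing) auto
    finally have "C < K * s ^ Suc n" using K(1) by (simp add: field_simps)
    then show False using C[OF _ K(2)[of "Suc n"]] by simp
  qed
  then have bdd: "bdd_above A" by (rule bdd_aboveI[of _ 1])
  define t where "t = Sup A"
  have t: "\<delta> \<le> t" "t \<le> 1"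
    unfolding t_def using \<delta>A A1 by (auto intro!: cSup_upper bdd cSup_least)
  have balanced: "\<exists>K>0. \<forall>n\<ge>1. \<forall>E\<in>cofin. \<exists>x. \<forall>i\<le>n. (T ^^ i) x \<in> E \<and>
        K / \<rho> ^ n * t ^ i \<le> norm ((T ^^ i) x) \<and> norm ((T ^^ i) x) \<le> \<rho> ^ n / K * t ^ i" if \<rho>: "\<rho> > 1" for \<rho>
  proof -
    \<comment> \<open>The loss \<rho> is split in two: one \<sigma> for using a rate s slightly
      below t, one for an orbit that attains only the rate r = t \<sigma> at time n.\<close>
    define \<sigma> where "\<sigma> = sqrt \<rho>"
    have \<sigma>: "\<sigma> > 1" "\<sigma> * \<sigma> = \<rho>" using \<rho> by (auto simp: \<sigma>_def)
    have t0: "t > 0" using t(1) \<delta>(1) by simp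
    have "t / \<sigma> < Sup A" using t0 \<sigma> by (simp add: t_def[symmetric] field_simps)
    then obtain s where s: "s \<in> A" "t / \<sigma> < s" using less_cSupE \<delta>A by (metis empty_iff)
    then have s0: "s > 0" "t \<le> \<sigma> * s" using \<sigma> by (auto simp: A_def field_simps)
    obtain K where K: "K > 0" "\<And>n. ess_below n (K * s ^ n)" using s(1) by (auto simp: A_def)
    obtain F where F: "\<And>n. F n \<in> cofin" "\<And>n x. x \<in> F n \<Longrightarrow> K * s ^ n * norm x \<le> norm ((T ^^ n) x)"
      using K(2) unfolding ess_below_def by metis
    define r where "r = t * \<sigma>"
    have r: "\<delta> < r" "t < r" using t0 \<sigma> t(1) by (auto simp: r_def intro: le_less_trans)
    \<comment> \<open>A bound r^n for a single power would spread to all powers by division with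
      remainder, the remainder being covered by \<delta>. Then r would be a rate in A above its
      supremum.\<close>
    have notbelow: "\<not> ess_below n (r ^ n)" if n: "n \<ge> 1" for n
    proof
      assume bel: "ess_below n (r ^ n)"
      have "ess_below m ((\<delta> / r) ^ n * r ^ m)" for m
      proof -
        have "ess_below (n * (m div n) + 1 * (m mod n)) ((r ^ n) ^ (m div n) * \<delta> ^ (m mod n))"
          using \<delta> r by (intro ess_below_mult ess_below_power bel) auto
        moreover have "(\<delta> / r) ^ n * r ^ m \<le> (r ^ n) ^ (m div n) * \<delta> ^ (m mod n)"
        proof -
          have "(\<delta> / r) ^ n \<le> (\<delta> / r) ^ (m mod n)"
            using \<delta>(1) r(1) n by (intro power_decreasing) (auto intro: less_imp_le)
          then have "(\<delta> / r) ^ n * r ^ m \<le> (\<delta> / r) ^ (m mod n) * r ^ m"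
            using \<delta>(1) r(1) by (intro mult_right_mono) auto
          also have "(\<delta> / r) ^ (m mod n) * r ^ m = (\<delta> / r) ^ (m mod n) * ((r ^ n) ^ (m div n) * r ^ (m mod n))"
            by (simp add: power_mult[symmetric] power_add[symmetric])
          also have "\<dots> = (r ^ n) ^ (m div n) * \<delta> ^ (m mod n)"
            using \<delta>(1) r(1) by (simp add: power_divide)
          finally show ?thesis .
        qed
        ultimately show ?thesis using ess_below_mono by simp
      qed
      moreover have "r > 0" "(\<delta> / r) ^ n > 0" using \<delta>(1) r(1) by auto
      ultimately have "r \<in> A" unfolding A_def by blast
      then show False using r(2) cSup_upper[OF _ bdd] by (simp add: t_def leD)
    qed
    have "\<exists>x. \<forall>i\<le>n. (T ^^ i) x \<in> E \<and> K / \<rho> ^ n * t ^ i \<le> norm ((T ^^ i) x) \<and> norm ((T ^^ i) x) \<le> \<rho> ^ n / K * t ^ i"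
      if n: "n \<ge> 1" and E: "E \<in> cofin" for n E
    proof -
      \<comment> \<open>\<open>F i\<close> bounds T^i y from below in terms of y. That T^i y lies in
        \<open>F (n - i)\<close> bounds it from above, since otherwise T^n y would be too
        large.\<close>
      define G where "G = (\<Inter>i\<in>{..n}. ((T ^^ i) -` E \<inter> F i) \<inter> (T ^^ i) -` F (n - i))"
      have G: "G \<in> cofin" unfolding G_def by (intro cofin_INT cofin_Int cofin_pow_vimage E F(1)) auto
      obtain y where y: "y \<in> G" "norm ((T ^^ n) y) < r ^ n * norm y"
        using notbelow[OF n] G unfolding ess_below_def by (meson not_le)
      define c where "c = complex_of_real (1 / norm y)"
      have y0: "y \<noteq> 0" using y(2) pow_zero by auto
      have xn: "norm ((T ^^ i) (c *\<^sub>C y)) = norm ((T ^^ i) y) / norm y" for i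
        by (simp add: c_def pow_scale norm_scaleC norm_divide)
      have "(T ^^ i) (c *\<^sub>C y) \<in> E \<and> K / \<rho> ^ n * t ^ i \<le> norm ((T ^^ i) y) / norm y \<and> norm ((T ^^ i) y) / norm y \<le> \<rho> ^ n / K * t ^ i"
        if i: "i \<le> n" for i
      proof (intro conjI)
        have yi: "(T ^^ i) y \<in> E" "y \<in> F i" "(T ^^ i) y \<in> F (n - i)" using y(1) i by (auto simp: G_def)
        show "(T ^^ i) (c *\<^sub>C y) \<in> E"
          unfolding pow_scale using yi(1) cofin_subspace[OF E] complex_vector.subspace_scale by blast
        have pw: "t ^ j \<le> \<sigma> ^ n * s ^ j" if "j \<le> n" for j
        proof -
          have "t ^ j \<le> (\<sigma> * s) ^ j" using s0 t0 by (intro power_mono) auto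
          also have "\<dots> \<le> \<sigma> ^ n * s ^ j"
            unfolding power_mult_distrib using \<sigma> s0 that by (intro mult_right_mono power_increasing) auto
          finally show ?thesis .
        qed
        have \<rho>\<sigma>: "\<rho> ^ n = \<sigma> ^ n * \<sigma> ^ n" by (simp add: power_mult_distrib[symmetric] \<sigma>(2))
        have "K / \<rho> ^ n * t ^ i \<le> K / \<rho> ^ n * (\<rho> ^ n * s ^ i)"
        proof (intro mult_left_mono)
          have "1 * \<sigma> ^ n * s ^ i \<le> \<sigma> ^ n * \<sigma> ^ n * s ^ i"
            using \<sigma>(1) s0 by (intro mult_right_mono) (auto intro: one_le_power)
          then show "t ^ i \<le> \<rho> ^ n * s ^ i" using pw[OF i] \<rho>\<sigma> by simp
        qed (use K \<rho> in auto)
        also have "\<dots> = K * s ^ i" using \<rho> by simp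
        also have "\<dots> \<le> norm ((T ^^ i) y) / norm y" using F(2)[OF yi(2)] y0 by (simp add: field_simps)
        finally show "K / \<rho> ^ n * t ^ i \<le> norm ((T ^^ i) y) / norm y" .
        have "K * s ^ (n - i) * norm ((T ^^ i) y) \<le> norm ((T ^^ (n - i)) ((T ^^ i) y))" by (rule F(2)[OF yi(3)])
        also have "(T ^^ (n - i)) ((T ^^ i) y) = (T ^^ n) y"
          using i by (metis comp_apply funpow_add le_add_diff_inverse2)
        also have "norm ((T ^^ n) y) \<le> r ^ n * norm y" using y(2) by simp
        also have "r ^ n = t ^ i * t ^ (n - i) * \<sigma> ^ n"
          using i by (simp add: r_def power_mult_distrib power_add[symmetric])
        also have "\<dots> \<le> t ^ i * (\<sigma> ^ n * s ^ (n - i)) * \<sigma> ^ n"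
          using pw[of "n - i"] t0 \<sigma> by (intro mult_right_mono mult_left_mono) auto
        finally have "s ^ (n - i) * (K * norm ((T ^^ i) y)) \<le> s ^ (n - i) * (\<rho> ^ n * t ^ i * norm y)"
          by (simp add: mult_ac \<rho>\<sigma> mult_right_mono)
        then have "K * norm ((T ^^ i) y) \<le> \<rho> ^ n * t ^ i * norm y" using s0(1) by simp
        then show "norm ((T ^^ i) y) / norm y \<le> \<rho> ^ n / K * t ^ i" using y0 K(1) by (simp add: field_simps)
      qed
      then show ?thesis using xn by (intro exI[of _ "c *\<^sub>C y"]) simp
    qed
    then show ?thesis using K(1) by blast
  qed
  then show ?thesis using that[of t] t \<delta>(1) by simp
qed

text \<open>A lower bound c at \<mu> persists as c/2 on the disc of radius c/2 around \<mu>;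
  finitely many such discs cover the circle.\<close>

lemma uniform_on_circle:
  assumes "\<And>\<alpha>. cmod \<alpha> = t \<Longrightarrow> \<exists>E\<in>cofin. \<exists>c>0. \<forall>x\<in>E. c * norm x \<le> norm (T x - \<alpha> *\<^sub>C x)"
  obtains E c where "E \<in> cofin" "c > 0"
    "\<And>\<alpha> x. cmod \<alpha> = t \<Longrightarrow> x \<in> E \<Longrightarrow> c * norm x \<le> norm (T x - \<alpha> *\<^sub>C x)"
proof -
  obtain E c where Ec: "\<And>\<alpha>. cmod \<alpha> = t \<Longrightarrow> E \<alpha> \<in> cofin \<and> c \<alpha> > 0"
    "\<And>\<alpha> x. cmod \<alpha> = t \<Longrightarrow> x \<in> E \<alpha> \<Longrightarrow> c \<alpha> * norm x \<le> norm (T x - \<alpha> *\<^sub>C x)"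
    using assms by metis
  have "sphere 0 t \<subseteq> (\<Union>\<alpha>\<in>sphere 0 t. ball \<alpha> (c \<alpha> / 2))" using Ec(1) by auto
  then obtain S where S: "S \<subseteq> sphere 0 t" "finite S" "sphere 0 t \<subseteq> (\<Union>\<alpha>\<in>S. ball \<alpha> (c \<alpha> / 2))"
    by (rule compactE_image[OF compact_sphere open_ball])
  define d where "d = Min (insert 1 ((\<lambda>\<alpha>. c \<alpha> / 2) ` S))"
  have "d > 0" unfolding d_def using S(1,2) Ec(1) by auto
  have d: "d \<le> c \<alpha> / 2" if "\<alpha> \<in> S" for \<alpha>
    unfolding d_def using S(2) that by (intro Min_le) auto
  have "(\<Inter>\<alpha>\<in>S. E \<alpha>) \<in> cofin" using S Ec(1) by (intro cofin_INT) auto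
  moreover have "d * norm x \<le> norm (T x - \<alpha> *\<^sub>C x)" if \<alpha>: "cmod \<alpha> = t" "x \<in> (\<Inter>\<alpha>\<in>S. E \<alpha>)" for \<alpha> x
  proof -
    obtain \<mu> where \<mu>: "\<mu> \<in> S" "cmod (\<mu> - \<alpha>) < c \<mu> / 2" using S(3) \<alpha>(1) by (force simp: dist_norm)
    have "T x - \<mu> *\<^sub>C x = (T x - \<alpha> *\<^sub>C x) - (\<mu> - \<alpha>) *\<^sub>C x"
      by (simp add: complex_vector.scale_left_diff_distrib)
    then have "norm (T x - \<mu> *\<^sub>C x) \<le> norm (T x - \<alpha> *\<^sub>C x) + cmod (\<mu> - \<alpha>) * norm x"
      by (metis norm_scaleC norm_triangle_ineq4)
    moreover have "c \<mu> * norm x \<le> norm (T x - \<mu> *\<^sub>C x)" using Ec(2) \<mu>(1) S(1) that(2) by auto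
    moreover have "cmod (\<mu> - \<alpha>) * norm x \<le> c \<mu> / 2 * norm x" using \<mu>(2) by (intro mult_right_mono) auto
    moreover have "d * norm x \<le> c \<mu> / 2 * norm x" using d[OF \<mu>(1)] by (intro mult_right_mono) auto
    ultimately show ?thesis by (simp add: field_simps)
  qed
  ultimately show ?thesis using \<open>d > 0\<close> that by blast
qed

lemma bounded_operator_scale: "bounded_operator (\<lambda>x. \<mu> *\<^sub>C T x)"
proof (rule bounded_operator.intro)
  interpret L: Vector_Spaces.linear "(*\<^sub>C)" "(*\<^sub>C)" T by (rule linear)
  show "Vector_Spaces.linear (*\<^sub>C) (*\<^sub>C) (\<lambda>x. \<mu> *\<^sub>C T x)"
    by unfold_locales (auto simp: L.add L.scale complex_vector.scale_right_distrib mult.commute)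
  show "continuous_on UNIV (\<lambda>x. \<mu> *\<^sub>C T x)"
    using continuous_on_compose2[OF linear_continuous_on[OF bounded_linear_scaleC_right] cont] by auto
qed

lemma scale_funpow: "((\<lambda>x. \<mu> *\<^sub>C T x) ^^ n) x = \<mu> ^ n *\<^sub>C (T ^^ n) x"
  by (induction n) (use pow_scale[of 1] in auto)

lemma approximate_eigenvalue:
  assumes C: "\<And>n E. n \<ge> 1 \<Longrightarrow> E \<in> cofin \<Longrightarrow> \<exists>x\<in>E. x \<noteq> 0 \<and> norm ((T ^^ n) x) \<le> C * norm x"
  obtains \<alpha> where "cmod \<alpha> \<le> 1"
    "\<And>E \<epsilon>. E \<in> cofin \<Longrightarrow> \<epsilon> > 0 \<Longrightarrow> \<exists>x\<in>E. norm x = 1 \<and> norm (T x - \<alpha> *\<^sub>C x) < \<epsilon>"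
proof -
  have main: "\<exists>\<alpha>. cmod \<alpha> \<le> 1 \<and> (\<forall>E\<in>cofin. \<forall>\<epsilon>>0. \<exists>x\<in>E. \<not> \<epsilon> * norm x \<le> norm (T x - \<alpha> *\<^sub>C x))"
  proof (cases "\<exists>\<delta>>0. ess_below 1 \<delta>")
    case False
    \<comment> \<open>Without any lower bound for \<open>T\<close> itself, 0 is the approximate
      eigenvalue.\<close>
    then show ?thesis unfolding ess_below_def by (intro exI[of _ 0]) auto
  next
    case True
    then obtain \<delta> where \<delta>: "\<delta> > 0" "ess_below 1 \<delta>" by blast
    have "c \<le> C" if n: "n \<ge> 1" and c: "ess_below n c" for n c
    proof -
      obtain E where E: "E \<in> cofin" "\<And>x. x \<in> E \<Longrightarrow> c * norm x \<le> norm ((T ^^ n) x)"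
        using c by (auto simp: ess_below_def)
      obtain x where "x \<in> E" "x \<noteq> 0" "norm ((T ^^ n) x) \<le> C * norm x" using C[OF n E(1)] by blast
      then show ?thesis using E(2)[of x] by (meson mult_le_cancel_right_pos order_trans zero_less_norm_iff)
    qed
    then obtain t where t: "0 < t" "t \<le> 1"
      and balanced: "\<And>\<rho>. \<rho> > 1 \<Longrightarrow> \<exists>K>0. \<forall>n\<ge>1. \<forall>E\<in>cofin. \<exists>x. \<forall>i\<le>n. (T ^^ i) x \<in> E \<and>
        K / \<rho> ^ n * t ^ i \<le> norm ((T ^^ i) x) \<and> norm ((T ^^ i) x) \<le> \<rho> ^ n / K * t ^ i"
      using balanced_orbits[OF \<delta>] by metis
    have "\<exists>\<alpha>. cmod \<alpha> = t \<and> (\<forall>E\<in>cofin. \<forall>\<epsilon>>0. \<exists>x\<in>E. \<not> \<epsilon> * norm x \<le> norm (T x - \<alpha> *\<^sub>C x))"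
    proof (rule ccontr)
      assume "\<not> ?thesis"
      then have "\<exists>E\<in>cofin. \<exists>c>0. \<forall>x\<in>E. c * norm x \<le> norm (T x - \<alpha> *\<^sub>C x)" if "cmod \<alpha> = t" for \<alpha>
        using that by blast
      then obtain E c where E: "E \<in> cofin" and c: "c > 0"
        and below: "\<And>\<alpha> x. cmod \<alpha> = t \<Longrightarrow> x \<in> E \<Longrightarrow> c * norm x \<le> norm (T x - \<alpha> *\<^sub>C x)"
        using uniform_on_circle by metis
      define \<kappa> where "\<kappa> = c / t"
      have \<kappa>: "\<kappa> > 0" using c t by (simp add: \<kappa>_def)
      \<comment> \<open>The final comparison loses three factors 2^k: from expanding (S^q - 1)^k,
        from the imbalance of the orbit, and from the number n + 1 of coefficients. Hence 8.\<close>
      obtain q where q: "8 / \<kappa> < real q" using reals_Archimedean2 by blast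
      then have \<kappa>q: "8 \<le> \<kappa> * real q" using \<kappa> by (simp add: field_simps)
      \<comment> \<open>Chosen so that \<rho>^(2 n) = 2^k for the orbit length n = k (q + 1) used
        below. The constant \<open>K\<close> depends on \<rho> but not on k, so k can be taken large
        afterwards.\<close>
      define \<rho> where "\<rho> = root (2 * (q + 1)) 2"
      have \<rho>: "\<rho> > 1" "\<rho> ^ (2 * (q + 1)) = 2" unfolding \<rho>_def by (auto simp: real_root_gt_1_iff simp del: power_Suc)
      obtain K where K: "K > 0"
        and bal: "\<And>n E. n \<ge> 1 \<Longrightarrow> E \<in> cofin \<Longrightarrow> \<exists>x. \<forall>i\<le>n. (T ^^ i) x \<in> E \<and>
        K / \<rho> ^ n * t ^ i \<le> norm ((T ^^ i) x) \<and> norm ((T ^^ i) x) \<le> \<rho> ^ n / K * t ^ i"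
        using balanced[OF \<rho>(1)] by blast
      have "(\<lambda>k. real (q + 1) * (real k * (1/2) ^ k) + (1/2) ^ k) \<longlonglongrightarrow> real (q + 1) * 0 + 0"
        using powser_times_n_limit_0[of "1/2::real"]
        by (intro tendsto_add tendsto_mult tendsto_const LIMSEQ_realpow_zero) auto
      then have "eventually (\<lambda>k. real (q + 1) * (real k * (1/2) ^ k) + (1/2) ^ k < K\<^sup>2) sequentially"
        using K by (intro order_tendstoD(2)) auto
      then obtain k where k: "k \<ge> 1" "real (q + 1) * (real k * (1/2) ^ k) + (1/2) ^ k < K\<^sup>2"
        using eventually_happens'[OF sequentially_bot eventually_conj[OF eventually_ge_at_top[of 1]]] by blast
      define n where "n = k * (q + 1)"
      have nK: "real (n + 1) < K\<^sup>2 * 2 ^ k"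
        using k(2) by (simp add: n_def field_simps)
      have n1: "n \<ge> 1" using k(1) by (simp add: n_def)
      have \<rho>n: "\<rho> ^ n * \<rho> ^ n = 2 ^ k"
      proof -
        have "\<rho> ^ n * \<rho> ^ n = (\<rho> ^ (2 * (q + 1))) ^ k"
          unfolding power_add[symmetric] power_mult[symmetric] by (rule arg_cong[of _ _ "\<lambda>m. \<rho> ^ m"]) (simp add: n_def algebra_simps)
        then show ?thesis by (simp only: \<rho>(2))
      qed
      define D where "D = \<rho> ^ n / K"
      have D0: "D > 0" using \<rho> K by (simp add: D_def)
      obtain x where x: "\<And>i. i \<le> n \<Longrightarrow> (T ^^ i) x \<in> E" "\<And>i. i \<le> n \<Longrightarrow> t ^ i / D \<le> norm ((T ^^ i) x)"
         "\<And>i. i \<le> n \<Longrightarrow> norm ((T ^^ i) x) \<le> D * t ^ i"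
        using bal[OF n1 E] by (auto simp: D_def mult.commute)
      define w where "w = coeff (geom_poly q ^ k)"
      define V where "V = 2 ^ k * D / \<kappa> ^ k"
      define y where "y j = (w j / of_real t ^ j) *\<^sub>C (T ^^ j) x" for j
      have V: "norm (\<Sum>j\<le>n. \<zeta> ^ j *\<^sub>C y j) \<le> V" if \<zeta>: "cmod \<zeta> = 1" for \<zeta>
      proof -
        \<comment> \<open>Rotating the coefficients by \<zeta> amounts to replacing \<open>T\<close>
          by T/\<alpha> with \<alpha> on the circle of radius t, where the uniform lower bound
          applies; \<kappa> is that bound for T/\<alpha> - 1.\<close>
        define \<alpha> where "\<alpha> = of_real t / \<zeta>"
        have \<zeta>0: "\<zeta> \<noteq> 0" using \<zeta> by auto
        have \<alpha>: "cmod \<alpha> = t" "\<alpha> \<noteq> 0" using \<zeta> \<zeta>0 t by (auto simp: \<alpha>_def norm_divide)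
        let ?S = "\<lambda>x. (1 / \<alpha>) *\<^sub>C T x"
        interpret S: bounded_operator ?S by (rule bounded_operator_scale)
        have "\<kappa> ^ k * norm (S.poly_op (geom_poly q ^ k) x) \<le> 2 ^ k * D"
        proof (rule S.poly_op_geom_bound[OF cofin_subspace[OF E]])
          show "\<kappa> * norm z \<le> norm (?S z - z)" if "z \<in> E" for z
          proof -
            have "?S z - z = (1 / \<alpha>) *\<^sub>C (T z - \<alpha> *\<^sub>C z)"
              using \<alpha>(2) by (simp add: complex_vector.scale_right_diff_distrib)
            then have "norm (?S z - z) = norm (T z - \<alpha> *\<^sub>C z) / t"
              using \<alpha>(1) by (simp add: norm_scaleC norm_divide)
            then show ?thesis using below[OF \<alpha>(1) that] t(1) by (simp add: \<kappa>_def divide_right_mono)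
          qed
          show "(?S ^^ i) x \<in> E" if "i \<le> k * (q + 1)" for i
            unfolding scale_funpow using x(1) that cofin_subspace[OF E] complex_vector.subspace_scale
            by (metis n_def)
          show "norm ((?S ^^ i) x) \<le> D" if "i \<le> k * (q + 1)" for i
            unfolding scale_funpow using x(3)[of i] that t(1) \<alpha>(1)
            by (simp add: norm_scaleC norm_divide norm_power n_def field_simps)
        qed (use \<kappa> in auto)
        also have "S.poly_op (geom_poly q ^ k) x = (\<Sum>j\<le>n. w j *\<^sub>C (?S ^^ j) x)"
          unfolding w_def using degree_geom_poly_power[of q k] by (intro S.poly_op_eq) (simp add: n_def)
        also have "\<dots> = (\<Sum>j\<le>n. \<zeta> ^ j *\<^sub>C y j)"
          unfolding scale_funpow y_def \<alpha>_def by (simp add: power_divide mult_ac)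
        finally show ?thesis unfolding V_def using \<kappa> by (simp add: field_simps)
      qed
      \<comment> \<open>The lower estimate for the orbit turns the bound on the vector
        \<open>y i\<close> into one on the scalar \<open>w i\<close>.\<close>
      have w: "cmod (w i) \<le> V * D" if "i \<le> n" for i
      proof -
        have "cmod (w i) / D = cmod (w i) / t ^ i * (t ^ i / D)" using t by simp
        also have "\<dots> \<le> cmod (w i) / t ^ i * norm ((T ^^ i) x)"
          using x(2)[OF that] t by (intro mult_left_mono) auto
        also have "\<dots> = norm (y i)" using t by (simp add: y_def norm_scaleC norm_divide norm_power)
        also have "\<dots> \<le> V" using trig_sum_coeff_bound[OF V that] .
        finally show ?thesis using D0 by (simp add: field_simps)
      qed
      have "real q ^ k \<le> (\<Sum>i\<le>n. cmod (w i))"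
        unfolding w_def by (rule sum_coeff_geom_poly_power) (simp add: n_def)
      also have "\<dots> \<le> (\<Sum>i\<le>n. V * D)" using w by (intro sum_mono) auto
      also have "\<dots> = real (n + 1) * (V * D)" by simp
      finally have "\<kappa> ^ k * real q ^ k \<le> \<kappa> ^ k * (real (n + 1) * (V * D))" using \<kappa> by (intro mult_left_mono) auto
      also have "\<dots> = real (n + 1) * (2 ^ k * (D * D))" using \<kappa> by (simp add: V_def)
      also have "D * D = 2 ^ k / K\<^sup>2" unfolding D_def using \<rho>n by (simp add: power2_eq_square)
      also have "real (n + 1) * (2 ^ k * (2 ^ k / K\<^sup>2)) = (real (n + 1) / K\<^sup>2) * (2 ^ k * 2 ^ k)" by simp
      also have "\<dots> < 2 ^ k * (2 ^ k * 2 ^ k)"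
        using nK K by (intro mult_strict_right_mono) (auto simp: field_simps)
      also have "\<dots> = 8 ^ k" by (simp add: power_mult_distrib[symmetric])
      also have "\<dots> \<le> (\<kappa> * real q) ^ k" using \<kappa>q by (intro power_mono) auto
      finally show False by (simp add: power_mult_distrib)
    qed
    then show ?thesis using t(2) by auto
  qed
  then obtain \<alpha> where \<alpha>: "cmod \<alpha> \<le> 1"
    "\<And>E \<epsilon>. E \<in> cofin \<Longrightarrow> \<epsilon> > 0 \<Longrightarrow> \<exists>x\<in>E. \<not> \<epsilon> * norm x \<le> norm (T x - \<alpha> *\<^sub>C x)" by blast
  have "\<exists>x\<in>E. norm x = 1 \<and> norm (T x - \<alpha> *\<^sub>C x) < \<epsilon>" if E: "E \<in> cofin" and \<epsilon>: "\<epsilon> > 0" for E \<epsilon>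
  proof -
    obtain x where x: "x \<in> E" "norm (T x - \<alpha> *\<^sub>C x) < \<epsilon> * norm x" using \<alpha>(2)[OF E \<epsilon>] by (auto simp: not_le)
    then have x0: "x \<noteq> 0" using pow_zero[of 1] by auto
    define u where "u = complex_of_real (1 / norm x) *\<^sub>C x"
    have "T u - \<alpha> *\<^sub>C u = complex_of_real (1 / norm x) *\<^sub>C (T x - \<alpha> *\<^sub>C x)"
      unfolding u_def using pow_scale[of 1 _ x] by (simp add: complex_vector.scale_right_diff_distrib mult.commute)
    then have "norm (T u - \<alpha> *\<^sub>C u) = norm (T x - \<alpha> *\<^sub>C x) / norm x" by (simp add: norm_scaleC norm_divide)
    also have "\<dots> < \<epsilon>" using x(2) x0 by (simp add: field_simps)
    finally have "norm (T u - \<alpha> *\<^sub>C u) < \<epsilon>" .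
    moreover have "u \<in> E" unfolding u_def using x(1) cofin_subspace[OF E] complex_vector.subspace_scale by blast
    moreover have "norm u = 1" using x0 by (simp add: u_def norm_scaleC norm_divide)
    ultimately show ?thesis by blast
  qed
  then show ?thesis using \<alpha>(1) that by blast
qed

end

section \<open>Weak mixing and the construction of the subspace\<close>

lemma map_prod_funpow:
  fixes f :: "'a \<Rightarrow> 'a" and g :: "'b \<Rightarrow> 'b"
  shows "map_prod f g ^^ n = map_prod (f ^^ n) (g ^^ n)"
  by (induction n) (auto simp: map_prod.id map_prod.comp)

lemma weakly_mixing_pair:
  assumes "weakly_mixing T" "open U" "U \<noteq> {}" "open V" "V \<noteq> {}" "open U'" "U' \<noteq> {}" "open V'" "V' \<noteq> {}"
  obtains n x y where "x \<in> U" "(T ^^ n) x \<in> V" "y \<in> U'" "(T ^^ n) y \<in> V'"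
proof -
  have "open (U \<times> U') \<and> U \<times> U' \<noteq> {} \<and> open (V \<times> V') \<and> V \<times> V' \<noteq> {}"
    using assms(2-9) by (simp add: open_Times)
  then obtain n where "(map_prod T T ^^ n) ` (U \<times> U') \<inter> (V \<times> V') \<noteq> {}"
    using assms(1) unfolding weakly_mixing_def topologically_transitive_def by metis
  then show ?thesis using that by (auto simp: map_prod_funpow)
qed

context bounded_operator
begin

lemma open_pow_vimage: "open U \<Longrightarrow> open ((T ^^ n) -` U)"
  using linear_continuous_on[OF pow_bounded_linear, of UNIV n] by (simp add: open_vimage)

text \<open>Furstenberg's intersection lemma: the sets of return times of a weakly mixing operator form a
  filter base.\<close>

lemma weakly_mixing_family:
  assumes wm: "weakly_mixing T" and "finite I"
    and "\<And>i. i \<in> I \<Longrightarrow> open (U i) \<and> U i \<noteq> {} \<and> open (V i) \<and> V i \<noteq> {}"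
  shows "\<exists>A B. open A \<and> A \<noteq> {} \<and> open B \<and> B \<noteq> {} \<and>
    (\<forall>n x. x \<in> A \<and> (T ^^ n) x \<in> B \<longrightarrow> (\<forall>i\<in>I. \<exists>y\<in>U i. (T ^^ n) y \<in> V i))"
  using assms(2,3)
proof (induction I)
  case empty
  show ?case by (intro exI[of _ UNIV]) auto
next
  case (insert i I)
  then obtain A B where AB: "open A" "A \<noteq> {}" "open B" "B \<noteq> {}"
    "\<And>n x. x \<in> A \<Longrightarrow> (T ^^ n) x \<in> B \<Longrightarrow> \<forall>i\<in>I. \<exists>y\<in>U i. (T ^^ n) y \<in> V i" by (metis insertCI)
  have i: "open (U i)" "U i \<noteq> {}" "open (V i)" "V i \<noteq> {}" using insert.prems by auto
  obtain n x y where n: "x \<in> A" "(T ^^ n) x \<in> U i" "y \<in> B" "(T ^^ n) y \<in> V i"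
    using weakly_mixing_pair[OF wm AB(1,2) i(1,2) AB(3,4) i(3,4)] by metis
  \<comment> \<open>T^n maps the shrunk sets into \<open>U i\<close> and \<open>V i\<close>. Since
    powers of \<open>T\<close> commute, a passage from the first to the second at time m is carried
    by T^n to a passage from \<open>U i\<close> to \<open>V i\<close> at the same time.\<close>
  let ?A = "A \<inter> (T ^^ n) -` U i" and ?B = "B \<inter> (T ^^ n) -` V i"
  have "open ?A" "?A \<noteq> {}" "open ?B" "?B \<noteq> {}" using AB i n open_pow_vimage by auto
  moreover have "\<exists>y\<in>U j. (T ^^ m) y \<in> V j" if "x \<in> ?A" "(T ^^ m) x \<in> ?B" "j \<in> insert i I" for m x j
  proof (cases "j = i")
    case True
    have "(T ^^ m) ((T ^^ n) x) = (T ^^ n) ((T ^^ m) x)"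
      by (metis add.commute comp_apply funpow_add)
    then show ?thesis using that True by (intro bexI[of _ "(T ^^ n) x"]) auto
  next
    case False
    then show ?thesis using AB(5)[of x m] that by auto
  qed
  ultimately show ?case by (intro exI[of _ ?A] exI[of _ ?B]) blast
qed

text \<open>Transitivity admits the time 0. It is excluded by also demanding a passage between
  disjoint neighbourhoods of 0 and \<open>v\<close>.\<close>

lemma weakly_mixing_return_time:
  assumes wm: "weakly_mixing T" and "finite I"
    and "\<And>i. i \<in> I \<Longrightarrow> open (U i) \<and> U i \<noteq> {} \<and> open (V i) \<and> V i \<noteq> {}" and nontrivial: "v \<noteq> (0::'a)"
  obtains n y where "n \<ge> 1" "\<And>i. i \<in> I \<Longrightarrow> y i \<in> U i \<and> (T ^^ n) (y i) \<in> V i"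
proof -
  obtain A B where AB: "open A" "A \<noteq> {}" "open B" "B \<noteq> {}"
    "\<And>n x. x \<in> A \<Longrightarrow> (T ^^ n) x \<in> B \<Longrightarrow> \<forall>i\<in>I. \<exists>y\<in>U i. (T ^^ n) y \<in> V i"
    using weakly_mixing_family[OF wm assms(2), of U V, OF assms(3)] by metis
  obtain G H where GH: "open G" "open H" "0 \<in> G" "v \<in> H" "G \<inter> H = {}"
    using hausdorff[OF nontrivial[symmetric]] by metis
  then have "G \<noteq> {}" "H \<noteq> {}" by auto
  then obtain n x y where n: "x \<in> A" "(T ^^ n) x \<in> B" "y \<in> G" "(T ^^ n) y \<in> H"
    using weakly_mixing_pair[OF wm AB(1-4), of G H] GH by metis
  have "n \<ge> 1"
  proof (rule ccontr)
    assume "\<not> n \<ge> 1"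
    then have "n = 0" by simp
    then show False using n(3,4) GH(5) by auto
  qed
  moreover obtain y where "\<And>i. i \<in> I \<Longrightarrow> y i \<in> U i \<and> (T ^^ n) (y i) \<in> V i"
    using AB(5)[OF n(1,2)] by metis
  ultimately show ?thesis using that by blast
qed

text \<open>The error at a fixed time is linear in the defect of x as an eigenvector, so a vector
  chosen after finitely many times can be made good for all of them.\<close>

lemma pow_eigen_error:
  assumes B: "B \<ge> 1" "\<And>x. norm (T x) \<le> B * norm x" and \<alpha>: "cmod \<alpha> \<le> 1"
  shows "norm ((T ^^ n) x - \<alpha> ^ n *\<^sub>C x) \<le> real n * B ^ n * norm (T x - \<alpha> *\<^sub>C x)"
proof (induction n)
  case (Suc n)
  let ?d = "norm (T x - \<alpha> *\<^sub>C x)"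
  have "(T ^^ Suc n) x - \<alpha> ^ Suc n *\<^sub>C x = (T ^^ n) (T x - \<alpha> *\<^sub>C x) + \<alpha> *\<^sub>C ((T ^^ n) x - \<alpha> ^ n *\<^sub>C x)"
    by (simp add: pow_diff pow_scale funpow_swap1 complex_vector.scale_right_diff_distrib)
  also have "norm \<dots> \<le> norm ((T ^^ n) (T x - \<alpha> *\<^sub>C x)) + cmod \<alpha> * norm ((T ^^ n) x - \<alpha> ^ n *\<^sub>C x)"
    by (metis norm_scaleC norm_triangle_ineq)
  also have "\<dots> \<le> B ^ n * ?d + 1 * (real n * B ^ n * ?d)"
    using pow_bound[OF _ B(2)] B(1) \<alpha> Suc by (intro add_mono mult_mono) auto
  also have "\<dots> = real (Suc n) * ?d * B ^ n" by (simp add: algebra_simps)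
  also have "\<dots> \<le> real (Suc n) * ?d * B ^ Suc n"
    using B(1) by (intro mult_left_mono power_increasing) auto
  finally show ?case by (simp add: mult_ac)
qed simp

text \<open>Here \<open>p s k\<close> is the correction made at stage \<open>s\<close> to the vector \<open>e k\<close>, and at the time \<open>n s\<close> the
  vectors corrected so far are sent near \<open>target s\<close>. The corrections are too small to spoil what was
  achieved at the earlier times.\<close>

lemma stages:
  assumes wm: "weakly_mixing T" and \<alpha>: "cmod \<alpha> \<le> 1"
    and eigen: "\<And>E \<epsilon>. E \<in> cofin \<Longrightarrow> \<epsilon> > 0 \<Longrightarrow> \<exists>x\<in>E. norm x = 1 \<and> norm (T x - \<alpha> *\<^sub>C x) < \<epsilon>"
  shows "\<exists>e n p. \<forall>s. norm (e s) = 1 \<and> n s \<ge> (1::nat) \<and>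
      (\<forall>i\<le>s. e s \<in> ortho_compl (e ` {..<i})) \<and>
      (\<forall>i<s. norm ((T ^^ n i) (e s) - \<alpha> ^ n i *\<^sub>C e s) \<le> (1/4) ^ s) \<and>
      (\<forall>k. norm (p s k) \<le> 1/64 * (1/4) ^ s) \<and>
      (\<forall>k. \<forall>i<s. norm ((T ^^ n i) (p s k)) \<le> (1/4) ^ s) \<and>
      (\<forall>k>s. p s k = 0) \<and>
      (\<forall>k\<le>s. norm ((T ^^ n s) (e k + (\<Sum>i\<le>s. p i k)) - target s k) \<le> (1/4) ^ s)"
proof -
  obtain B where B: "B \<ge> 1" "\<And>x. norm (T x) \<le> B * norm x" using bounded by metis
  \<comment> \<open>The case k = s is separated from k < s because the condition may consult only
    the earlier stages in \<open>f\<close>.\<close>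
  define P where "P f s r \<longleftrightarrow> (case r of (e, n, p) \<Rightarrow>
      norm e = 1 \<and> (\<forall>i\<le>s. e \<in> ortho_compl ((\<lambda>k. fst (f k)) ` {..<i})) \<and>
      (\<forall>i<s. norm ((T ^^ fst (snd (f i))) e - \<alpha> ^ fst (snd (f i)) *\<^sub>C e) \<le> (1/4) ^ s) \<and>
      n \<ge> 1 \<and> (\<forall>k. norm (p k) \<le> 1/64 * (1/4) ^ s) \<and>
      (\<forall>k. \<forall>i<s. norm ((T ^^ fst (snd (f i))) (p k)) \<le> (1/4) ^ s) \<and>
      (\<forall>k>s. p k = 0) \<and>
      norm ((T ^^ n) (e + p s) - target s s) \<le> (1/4) ^ s \<and>
      (\<forall>k<s. norm ((T ^^ n) (fst (f k) + (\<Sum>i<s. snd (snd (f i)) k) + p k) - target s k) \<le> (1/4) ^ s))"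
    for f :: "nat \<Rightarrow> 'a \<times> nat \<times> (nat \<Rightarrow> 'a)" and s :: nat and r :: "'a \<times> nat \<times> (nat \<Rightarrow> 'a)"
  have "\<exists>F. \<forall>s. P F s (F s)"
  proof (rule dependent_wellorder_choice)
    fix r s and f g :: "nat \<Rightarrow> 'a \<times> nat \<times> (nat \<Rightarrow> 'a)"
    assume fg: "\<And>k. k < s \<Longrightarrow> f k = g k"
    have "(\<lambda>k. fst (f k)) ` {..<i} = (\<lambda>k. fst (g k)) ` {..<i}" if "i \<le> s" for i
      using fg that by (intro image_cong) auto
    moreover have "(\<Sum>i<s. snd (snd (f i)) k) = (\<Sum>i<s. snd (snd (g i)) k)" for k
      using fg by (intro sum.cong) auto
    ultimately show "P f s r = P g s r"
      unfolding P_def using fg by (simp split: prod.split)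
  next
    fix s and f :: "nat \<Rightarrow> 'a \<times> nat \<times> (nat \<Rightarrow> 'a)"
    define \<epsilon> :: real where "\<epsilon> = (1/4) ^ s"
    have \<epsilon>: "\<epsilon> > 0" by (simp add: \<epsilon>_def)
    define N where "N i = fst (snd (f i))" for i
    \<comment> \<open>\<open>c\<close> and \<open>c'\<close> bound the amplification, at all earlier
      times, of an eigenvector defect and of a correction.\<close>
    define c where "c = 1 + (\<Sum>i<s. real (N i) * B ^ N i)"
    define c' where "c' = 1 + (\<Sum>i<s. B ^ N i)"
    have c: "c > 0" "\<And>i. i < s \<Longrightarrow> real (N i) * B ^ N i \<le> c"
      and c': "c' > 0" "\<And>i. i < s \<Longrightarrow> B ^ N i \<le> c'"
    proof -
      show "c > 0" "c' > 0" unfolding c_def c'_def using B(1) by (auto intro!: add_pos_nonneg sum_nonneg)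
      fix i assume i: "i < s"
      show "real (N i) * B ^ N i \<le> c"
        using member_le_sum[of i "{..<s}" "\<lambda>i. real (N i) * B ^ N i"] i B(1) by (simp add: c_def)
      show "B ^ N i \<le> c'" using member_le_sum[of i "{..<s}" "\<lambda>i. B ^ N i"] i B(1) by (simp add: c'_def)
    qed
    have "(\<Inter>i\<in>{..s}. ortho_compl ((\<lambda>k. fst (f k)) ` {..<i})) \<in> cofin"
      by (intro cofin_INT ortho_compl(1)) auto
    then obtain e where e: "norm e = 1" "\<And>i. i \<le> s \<Longrightarrow> e \<in> ortho_compl ((\<lambda>k. fst (f k)) ` {..<i})"
      "norm (T e - \<alpha> *\<^sub>C e) < \<epsilon> / c" using eigen[OF _ divide_pos_pos[OF \<epsilon> c(1)]] by blast
    have e4: "norm ((T ^^ N i) e - \<alpha> ^ N i *\<^sub>C e) \<le> \<epsilon>" if "i < s" for i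
    proof -
      have "norm ((T ^^ N i) e - \<alpha> ^ N i *\<^sub>C e) \<le> real (N i) * B ^ N i * norm (T e - \<alpha> *\<^sub>C e)"
        by (rule pow_eigen_error[OF B \<alpha>])
      also have "\<dots> \<le> c * (\<epsilon> / c)" using c e(3) that by (intro mult_mono) auto
      finally show ?thesis using c(1) by simp
    qed
    \<comment> \<open>With 1/64, the corrections from stage k on add up to at most (1/32) (1/4)^k,
      as \<open>basic_seq_perturb\<close> requires; \<epsilon> / c' protects the earlier
      times.\<close>
    define \<eta> where "\<eta> = min (\<epsilon> / 64) (\<epsilon> / c')"
    have \<eta>: "\<eta> > 0" using \<epsilon> c' by (simp add: \<eta>_def)
    define y where "y k = (if k = s then e else fst (f k) + (\<Sum>i<s. snd (snd (f i)) k))" for k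
    have "e \<noteq> 0" using e(1) by auto
    then obtain m x where m: "m \<ge> 1"
      and x: "\<And>k. k \<in> {..s} \<Longrightarrow> x k \<in> ball (y k) \<eta> \<and> (T ^^ m) (x k) \<in> ball (target s k) \<epsilon>"
    proof (rule weakly_mixing_return_time[OF wm, of "{..s}" "\<lambda>k. ball (y k) \<eta>" "\<lambda>k. ball (target s k) \<epsilon>", rotated 2])
      show "open (ball (y k) \<eta>) \<and> ball (y k) \<eta> \<noteq> {} \<and> open (ball (target s k) \<epsilon>) \<and> ball (target s k) \<epsilon> \<noteq> {}" for k
        using \<epsilon> \<eta> by simp
    qed auto
    define p where "p k = (if k \<le> s then x k - y k else 0)" for k
    have p: "norm (p k) \<le> \<eta>" for k
      using x[of k] \<eta> by (auto simp: p_def dist_norm norm_minus_commute less_imp_le)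
    have p2: "norm ((T ^^ N i) (p k)) \<le> \<epsilon>" if "i < s" for i k
    proof -
      have "norm ((T ^^ N i) (p k)) \<le> B ^ N i * norm (p k)" using pow_bound[OF _ B(2)] B(1) by simp
      also have "\<dots> \<le> c' * (\<epsilon> / c')" using c' p[of k] that by (intro mult_mono) (auto simp: \<eta>_def)
      finally show ?thesis using c' by simp
    qed
    have p3: "norm ((T ^^ m) (y k + p k) - target s k) \<le> \<epsilon>" if "k \<le> s" for k
      using x[of k] that by (simp add: p_def dist_norm norm_minus_commute)
    have "norm (p k) \<le> 1/64 * \<epsilon>" for k using p[of k] by (simp add: \<eta>_def)
    moreover have "norm ((T ^^ m) (e + p s) - target s s) \<le> \<epsilon>" using p3[of s] by (simp add: y_def)
    moreover have "norm ((T ^^ m) (fst (f k) + (\<Sum>i<s. snd (snd (f i)) k) + p k) - target s k) \<le> \<epsilon>" if "k < s" for k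
      using p3[of k] that by (simp add: y_def)
    moreover have "p k = 0" if "k > s" for k using that by (simp add: p_def)
    ultimately have "P f s (e, m, p)"
      unfolding P_def using e(1,2) e4 p2 m by (simp add: N_def \<epsilon>_def)
    then show "\<exists>r. P f s r" by blast
  qed
  then obtain F where F: "\<And>s. P F s (F s)" by blast
  define e n p where "e s = fst (F s)" and "n s = fst (snd (F s))" and "p s = snd (snd (F s))" for s
  have F': "norm (e s) = 1 \<and> (\<forall>i\<le>s. e s \<in> ortho_compl (e ` {..<i})) \<and>
      (\<forall>i<s. norm ((T ^^ n i) (e s) - \<alpha> ^ n i *\<^sub>C e s) \<le> (1/4) ^ s) \<and>
      n s \<ge> 1 \<and> (\<forall>k. norm (p s k) \<le> 1/64 * (1/4) ^ s) \<and>
      (\<forall>k. \<forall>i<s. norm ((T ^^ n i) (p s k)) \<le> (1/4) ^ s) \<and>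
      (\<forall>k>s. p s k = 0) \<and>
      norm ((T ^^ n s) (e s + p s s) - target s s) \<le> (1/4) ^ s \<and>
      (\<forall>k<s. norm ((T ^^ n s) (e k + (\<Sum>i<s. p i k) + p s k) - target s k) \<le> (1/4) ^ s)" for s
    using F[of s] unfolding P_def case_prod_unfold e_def n_def p_def by simp
  have last: "norm ((T ^^ n s) (e k + (\<Sum>i\<le>s. p i k)) - target s k) \<le> (1/4) ^ s" if "k \<le> s" for s k
  proof (cases "k = s")
    case True
    have "(\<Sum>i\<le>s. p i s) = (\<Sum>i\<in>{s}. p i s)" using F' by (intro sum.mono_neutral_right) auto
    then show ?thesis using F'[of s] True by simp
  next
    case False
    then have "norm ((T ^^ n s) (e k + (\<Sum>i<s. p i k) + p s k) - target s k) \<le> (1/4) ^ s" using F'[of s] that by auto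
    then show ?thesis by (simp add: lessThan_Suc_atMost[symmetric] add.assoc)
  qed
  show ?thesis
    using F' last by (intro exI[of _ e] exI[of _ n] exI[of _ p]) auto
qed

lemma hypercyclic_subspace_exists:
  fixes d :: "nat \<Rightarrow> 'a"
  assumes wm: "weakly_mixing T" and dense: "closure (range d) = UNIV" and \<alpha>: "cmod \<alpha> \<le> 1"
    and eigen: "\<And>E \<epsilon>. E \<in> cofin \<Longrightarrow> \<epsilon> > 0 \<Longrightarrow> \<exists>x\<in>E. norm x = 1 \<and> norm (T x - \<alpha> *\<^sub>C x) < \<epsilon>"
  shows "\<exists>M. hypercyclic_subspace T M"
proof -
  \<comment> \<open>A stage encodes an index j, an index l of a dense point, and a third free
    number, so every pair (j, l) recurs at arbitrarily late stages.\<close>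
  define J where "J s = fst (prod_decode s)" for s
  define W where "W s = d (fst (prod_decode (snd (prod_decode s))))" for s
  define target where "target s k = (if k = J s then W s else 0)" for s k
  obtain e n p where stage: "norm (e s) = 1 \<and> n s \<ge> (1::nat) \<and>
      (\<forall>i\<le>s. e s \<in> ortho_compl (e ` {..<i})) \<and>
      (\<forall>i<s. norm ((T ^^ n i) (e s) - \<alpha> ^ n i *\<^sub>C e s) \<le> (1/4) ^ s) \<and>
      (\<forall>k. norm (p s k) \<le> 1/64 * (1/4) ^ s) \<and>
      (\<forall>k. \<forall>i<s. norm ((T ^^ n i) (p s k)) \<le> (1/4) ^ s) \<and>
      (\<forall>k>s. p s k = 0) \<and>
      (\<forall>k\<le>s. norm ((T ^^ n s) (e k + (\<Sum>i\<le>s. p i k)) - target s k) \<le> (1/4) ^ s)" for s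
    using stages[OF wm \<alpha> eigen, of target] by auto
  have e1: "norm (e s) = 1" and n1: "n s \<ge> 1"
    and e2: "i \<le> s \<Longrightarrow> e s \<in> ortho_compl (e ` {..<i})"
    and e3: "i < s \<Longrightarrow> norm ((T ^^ n i) (e s) - \<alpha> ^ n i *\<^sub>C e s) \<le> (1/4) ^ s"
    and p1: "norm (p s k) \<le> 1/64 * (1/4) ^ s"
    and p2: "i < s \<Longrightarrow> norm ((T ^^ n i) (p s k)) \<le> (1/4) ^ s"
    and p3: "s < k \<Longrightarrow> p s k = 0"
    and corrected: "k \<le> s \<Longrightarrow> norm ((T ^^ n s) (e k + (\<Sum>i\<le>s. p i k)) - target s k) \<le> (1/4) ^ s" for s i k
    using stage[of s] by simp_all
  define z where "z k = e k + (\<Sum>i. p i k)" for k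
  have sump: "summable (\<lambda>i. p i k)" for k
    using p1 by (intro geometric_tail_bound[of 0 _ "1/64"]) auto
  \<comment> \<open>Corrections of the vector with index k start at stage k.\<close>
  have tail: "(\<Sum>i. p i k) = (\<Sum>i. p (i + k) k)" for k
    using suminf_split_initial_segment[OF sump, of k k] p3 by simp
  have ze: "norm (z k - e k) \<le> (1/32) * (1/4) ^ k" for k
    using geometric_tail_bound(2)[of k "\<lambda>i. p i k" "1/64"] p1 by (simp add: z_def tail)
  have "basic_seq z 4"
    using e1 ze ortho_partial_sums[of _ e] e2 by (intro basic_seq_perturb[of e]) auto
  then interpret basic_seq z 4 .
  have Tpsum: "(\<lambda>i. (T ^^ m) (p i k)) sums ((T ^^ m) (\<Sum>i. p i k))" for m k
    by (intro bounded_linear.sums[OF pow_bounded_linear] summable_sums sump)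
  have early: "norm ((T ^^ n s) (z k) - target s k) \<le> 2 * (1/4) ^ s" if "k \<le> s" for s k
  proof -
    have "(\<Sum>i. p i k) = (\<Sum>i. p (i + Suc s) k) + (\<Sum>i\<le>s. p i k)"
      using suminf_split_initial_segment[OF sump, of k "Suc s"] by (simp add: lessThan_Suc_atMost)
    then have "z k = (e k + (\<Sum>i\<le>s. p i k)) + (\<Sum>i. p (i + Suc s) k)" by (simp add: z_def)
    then have "(T ^^ n s) (z k) - target s k =
        ((T ^^ n s) (e k + (\<Sum>i\<le>s. p i k)) - target s k) + (T ^^ n s) (\<Sum>i. p (i + Suc s) k)"
      by (simp add: pow_add)
    also have "norm \<dots> \<le> (1/4) ^ s + 2 * 1 * (1/4) ^ Suc s"
    proof (rule norm_triangle_mono[OF corrected[OF that]])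
      have "(T ^^ n s) (\<Sum>i. p (i + Suc s) k) = (\<Sum>i. (T ^^ n s) (p (i + Suc s) k))"
        by (rule bounded_linear.suminf[OF pow_bounded_linear summable_ignore_initial_segment[OF sump]])
      also have "norm \<dots> \<le> 2 * 1 * (1/4) ^ Suc s"
        using p2 by (intro geometric_tail_bound) auto
      finally show "norm ((T ^^ n s) (\<Sum>i. p (i + Suc s) k)) \<le> 2 * 1 * (1/4) ^ Suc s" .
    qed
    also have "\<dots> \<le> 2 * (1/4) ^ s" by simp
    finally show ?thesis .
  qed
  have late: "norm ((T ^^ n s) (z k) - \<alpha> ^ n s *\<^sub>C e k) \<le> 3 * (1/4) ^ k" if "s < k" for s k
  proof -
    have "(T ^^ n s) (z k) - \<alpha> ^ n s *\<^sub>C e k = ((T ^^ n s) (e k) - \<alpha> ^ n s *\<^sub>C e k) + (T ^^ n s) (\<Sum>i. p (i + k) k)"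
      by (simp add: z_def tail pow_add)
    also have "norm \<dots> \<le> (1/4) ^ k + 2 * 1 * (1/4) ^ k"
    proof (rule norm_triangle_mono[OF e3[OF that]])
      have "(T ^^ n s) (\<Sum>i. p (i + k) k) = (\<Sum>i. (T ^^ n s) (p (i + k) k))"
        by (rule bounded_linear.suminf[OF pow_bounded_linear summable_ignore_initial_segment[OF sump]])
      also have "norm \<dots> \<le> 2 * 1 * (1/4) ^ k"
        using p2 that by (intro geometric_tail_bound) auto
      finally show "norm ((T ^^ n s) (\<Sum>i. p (i + k) k)) \<le> 2 * 1 * (1/4) ^ k" .
    qed
    finally show ?thesis by simp
  qed
  have "hypercyclic_vector T x" if x: "x \<in> series_space" "x \<noteq> 0" for x
  proof -
    obtain a where a: "(\<lambda>k. a k *\<^sub>C z k) sums x" using x(1) by (auto simp: series_space_def)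
    obtain j where j: "a j \<noteq> 0"
    proof (rule ccontr)
      assume "\<not> thesis"
      then have "a = (\<lambda>_. 0)" using that by auto
      then have "(\<lambda>k::nat. 0) sums x" using a by simp
      then show False using x(2) sums_unique2[OF _ sums_zero] by blast
    qed
    \<comment> \<open>\<open>coeff_bound\<close> with K = 4 gives 8 norm x, and norm (z k) \<ge> 1/2
      doubles it.\<close>
    define A where "A = 16 * norm x"
    have aA: "cmod (a k) \<le> A" for k
    proof -
      have "norm (e k) \<le> norm (z k) + norm (z k - e k)" using norm_triangle_ineq2[of "e k" "z k"] by (simp add: norm_minus_commute)
      moreover have "(1/4::real) ^ k \<le> 1" by (simp add: power_le_one)
      ultimately have "1/2 \<le> norm (z k)" using ze[of k] e1[of k] by simp
      then have "cmod (a k) * (1/2) \<le> cmod (a k) * norm (z k)" by (intro mult_left_mono) auto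
      also have "\<dots> \<le> 2 * 4 * norm x" by (rule coeff_bound[OF a])
      finally show ?thesis by (simp add: A_def)
    qed
    have A0: "A \<ge> 0" by (simp add: A_def)
    \<comment> \<open>With bounded coefficients this series converges absolutely, so convergence
      passes from the series in \<open>z\<close> to the one in \<open>e\<close>.\<close>
    have "summable (\<lambda>k. a k *\<^sub>C (z k - e k))"
    proof (rule geometric_tail_bound[of 0 _ "A * (1/32)"])
      show "norm (a k *\<^sub>C (z k - e k)) \<le> A * (1/32) * (1/4) ^ k" for k
        using mult_mono[OF aA ze A0 norm_ge_zero, of k k] by (simp add: norm_scaleC mult_ac)
    qed (use A0 in auto)
    from summable_diff[OF sums_summable[OF a] this] have sume: "summable (\<lambda>k. a k *\<^sub>C e k)"
      by (simp add: complex_vector.scale_right_diff_distrib)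
    \<comment> \<open>Up to index s the images are near their targets, which leaves a j W s. Beyond
      s the power acts on the tail nearly as the scalar \<alpha>^(n s).\<close>
    have error: "norm ((T ^^ n s) x - a j *\<^sub>C W s) \<le>
        2 * A * (real s * (1/4) ^ s + 2 * (1/4) ^ s) + norm (\<Sum>k. a (k + Suc s) *\<^sub>C e (k + Suc s))"
      if s: "J s = j" "j \<le> s" for s
    proof -
      let ?T = "T ^^ n s"
      let ?b = "\<lambda>k. a k *\<^sub>C (?T (z k) - \<alpha> ^ n s *\<^sub>C e k)"
      have b: "norm (?b k) \<le> 3 * A * (1/4) ^ k" if "k \<ge> Suc s" for k
        using mult_mono[OF aA late A0 norm_ge_zero, of s k k] that by (simp add: norm_scaleC mult_ac)
      have sumb: "summable ?b" "norm (\<Sum>k. ?b (k + Suc s)) \<le> 2 * (3 * A) * (1/4) ^ Suc s"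
        using geometric_tail_bound[of "Suc s" ?b "3 * A", OF b] A0 by auto
      have Tx: "(\<lambda>k. a k *\<^sub>C ?T (z k)) sums ?T x"
        using bounded_linear.sums[OF pow_bounded_linear a, of "n s"] by (simp add: pow_scale)
      have "?T x = (\<Sum>k. a (k + Suc s) *\<^sub>C ?T (z (k + Suc s))) + (\<Sum>k<Suc s. a k *\<^sub>C ?T (z k))"
        using suminf_split_initial_segment[OF sums_summable[OF Tx], of "Suc s"] sums_unique[OF Tx] by simp
      also have "(\<Sum>k. a (k + Suc s) *\<^sub>C ?T (z (k + Suc s))) =
          (\<Sum>k. ?b (k + Suc s)) + (\<Sum>k. \<alpha> ^ n s *\<^sub>C a (k + Suc s) *\<^sub>C e (k + Suc s))"
      proof (subst suminf_add)
        show "summable (\<lambda>k. ?b (k + Suc s))" by (rule summable_ignore_initial_segment[OF sumb(1)])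
        show "summable (\<lambda>k. \<alpha> ^ n s *\<^sub>C a (k + Suc s) *\<^sub>C e (k + Suc s))"
          by (rule bounded_linear.summable[OF bounded_linear_scaleC_right summable_ignore_initial_segment[OF sume]])
      qed (simp add: complex_vector.scale_right_diff_distrib mult.commute)
      also have "(\<Sum>k. \<alpha> ^ n s *\<^sub>C a (k + Suc s) *\<^sub>C e (k + Suc s)) = \<alpha> ^ n s *\<^sub>C (\<Sum>k. a (k + Suc s) *\<^sub>C e (k + Suc s))"
        by (rule bounded_linear.suminf[OF bounded_linear_scaleC_right summable_ignore_initial_segment[OF sume], symmetric])
      also have "(\<Sum>k<Suc s. a k *\<^sub>C ?T (z k)) = (\<Sum>k<Suc s. a k *\<^sub>C (?T (z k) - target s k)) + a j *\<^sub>C W s"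
      proof -
        have "(\<Sum>k<Suc s. a k *\<^sub>C target s k) = a j *\<^sub>C W s"
          using s by (simp add: target_def if_distrib[of "\<lambda>v. _ *\<^sub>C v"] cong: if_cong)
        then show ?thesis by (simp add: complex_vector.scale_right_diff_distrib sum_subtractf)
      qed
      finally have "?T x - a j *\<^sub>C W s = (\<Sum>k<Suc s. a k *\<^sub>C (?T (z k) - target s k)) +
          ((\<Sum>k. ?b (k + Suc s)) + \<alpha> ^ n s *\<^sub>C (\<Sum>k. a (k + Suc s) *\<^sub>C e (k + Suc s)))"
        by (simp add: algebra_simps)
      then have "norm (?T x - a j *\<^sub>C W s) \<le> (\<Sum>k<Suc s. A * (2 * (1/4) ^ s)) +
          (2 * (3 * A) * (1/4) ^ Suc s + 1 * norm (\<Sum>k. a (k + Suc s) *\<^sub>C e (k + Suc s)))"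
      proof (elim ssubst, intro norm_triangle_mono sumb(2))
        show "norm (\<Sum>k<Suc s. a k *\<^sub>C (?T (z k) - target s k)) \<le> (\<Sum>k<Suc s. A * (2 * (1/4) ^ s))"
        proof (rule sum_norm_le)
          fix k assume "k \<in> {..<Suc s}"
          then show "norm (a k *\<^sub>C (?T (z k) - target s k)) \<le> A * (2 * (1/4) ^ s)"
            unfolding norm_scaleC using aA A0 early by (intro mult_mono) auto
        qed
        show "norm (\<alpha> ^ n s *\<^sub>C (\<Sum>k. a (k + Suc s) *\<^sub>C e (k + Suc s))) \<le> 1 * norm (\<Sum>k. a (k + Suc s) *\<^sub>C e (k + Suc s))"
          unfolding norm_scaleC norm_power
          by (rule mult_right_mono[OF power_le_one[OF norm_ge_zero \<alpha>] norm_ge_zero])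
      qed
      moreover have "(\<Sum>k<Suc s. A * (2 * (1/4) ^ s)) + 2 * (3 * A) * (1/4) ^ Suc s
          \<le> 2 * A * (real s * (1/4) ^ s + 2 * (1/4) ^ s)"
        using A0 by (simp add: algebra_simps)
      ultimately show ?thesis by linarith
    qed
    have small: "eventually (\<lambda>s. 2 * A * (real s * (1/4) ^ s + 2 * (1/4) ^ s) +
        norm (\<Sum>k. a (k + Suc s) *\<^sub>C e (k + Suc s)) < r) sequentially" if r: "r > 0" for r
    proof -
      have "(\<lambda>s. 2 * A * (real s * (1/4) ^ s + 2 * (1/4) ^ s)) \<longlonglongrightarrow> 2 * A * (0 + 2 * 0)"
        using powser_times_n_limit_0[of "1/4::real"]
        by (intro tendsto_add tendsto_mult tendsto_const LIMSEQ_realpow_zero) auto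
      then have "eventually (\<lambda>s. 2 * A * (real s * (1/4) ^ s + 2 * (1/4) ^ s) < r/2) sequentially"
        using r by (intro order_tendstoD(2)) auto
      moreover obtain N where "\<And>m. m \<ge> N \<Longrightarrow> norm (\<Sum>k. a (k + m) *\<^sub>C e (k + m)) < r/2"
        using suminf_exist_split[OF _ sume, of "r/2"] r by auto
      then have "eventually (\<lambda>s. norm (\<Sum>k. a (k + Suc s) *\<^sub>C e (k + Suc s)) < r/2) sequentially"
        by (intro eventually_sequentiallyI[of N]) (meson le_SucI)
      ultimately show ?thesis by eventually_elim linarith
    qed
    have "y \<in> closure {(T ^^ n) x | n. n \<ge> 1}" for y
      unfolding closure_approachable
    proof (intro allI impI)
      fix r :: real assume r: "r > 0"
      define y' where "y' = (1 / a j) *\<^sub>C y"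
      have "r / (2 * cmod (a j)) > 0" using r j by simp
      then obtain l where l: "dist (d l) y' < r / (2 * cmod (a j))"
        using dense closure_approachable[of y' "range d"] by (metis UNIV_I imageE)
      obtain N where N: "\<And>s. s \<ge> N \<Longrightarrow> 2 * A * (real s * (1/4) ^ s + 2 * (1/4) ^ s) +
        norm (\<Sum>k. a (k + Suc s) *\<^sub>C e (k + Suc s)) < r/2"
        using small[of "r/2"] r unfolding eventually_sequentially by auto
      \<comment> \<open>The third entry N makes s \<ge> N. The dense point d l was taken near y / a
        j because the orbit comes close to a j times it.\<close>
      define s where "s = prod_encode (j, prod_encode (l, N))"
      have s: "J s = j" "W s = d l" by (simp_all add: s_def J_def W_def)
      have "j \<le> s" unfolding s_def by (rule le_prod_encode_1)
      have "N \<le> prod_encode (l, N)" by (rule le_prod_encode_2)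
      also have "\<dots> \<le> s" unfolding s_def by (rule le_prod_encode_2)
      finally have "norm ((T ^^ n s) x - a j *\<^sub>C d l) < r/2"
        using error[OF s(1) \<open>j \<le> s\<close>] N[of s] s(2) by simp
      moreover have "norm (a j *\<^sub>C d l - y) < r/2"
      proof -
        have "a j *\<^sub>C d l - y = a j *\<^sub>C (d l - y')"
          using j by (simp add: y'_def complex_vector.scale_right_diff_distrib)
        then have "norm (a j *\<^sub>C d l - y) = cmod (a j) * norm (d l - y')" by (simp only: norm_scaleC)
        also have "\<dots> < r/2" using l j by (simp add: dist_norm field_simps)
        finally show ?thesis .
      qed
      ultimately have "dist ((T ^^ n s) x) y < r"
        using norm_triangle_lt[of "(T ^^ n s) x - a j *\<^sub>C d l" "a j *\<^sub>C d l - y" r] by (simp add: dist_norm)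
      then show "\<exists>v\<in>{(T ^^ n) x | n. n \<ge> 1}. dist v y < r" using n1[of s] by blast
    qed
    then show ?thesis unfolding hypercyclic_vector_def by blast
  qed
  then have "hypercyclic_subspace T series_space"
    unfolding hypercyclic_subspace_def
    using subspace_series_space closed_series_space infinite_dim_series_space by blast
  then show ?thesis by blast
qed

end

section \<open>Separability and the two equivalences\<close>

lemma separable_dense_sequence:
  assumes "separable_space (euclidean :: 'a::topological_space topology)"
  obtains d :: "nat \<Rightarrow> 'a::topological_space" where "closure (range d) = UNIV"
proof -
  obtain C :: "'a set" where C: "countable C" "closure C = UNIV"
    using assms unfolding separable_space_def by auto
  then have "C \<noteq> {}" by auto
  then show ?thesis using that[of "from_nat_into C"] C range_from_nat_into by metis
qed

theorem corollary2p1: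
  fixes T :: "'a::complex_banach \<Rightarrow> 'a"
  assumes "separable_space (euclidean :: 'a topology)"
    and "Vector_Spaces.linear (*\<^sub>C) (*\<^sub>C) T"
    and "continuous_on UNIV T"
    and "weakly_mixing T"
  shows "((\<exists>M. hypercyclic_subspace T M) \<longleftrightarrow>
      (SUP n\<in>{1::nat..}. SUP E\<in>cofin. INF x\<in>E - {0}. ereal (norm ((T ^^ n) x) / norm x)) \<le> 1) \<and>
    ((\<exists>M. hypercyclic_subspace T M) \<longleftrightarrow>
      (SUP n\<in>{1::nat..}. SUP E\<in>cofin. INF x\<in>E - {0}. ereal (norm ((T ^^ n) x) / norm x)) < \<infinity>)"
proof -
  interpret bounded_operator T using assms(2,3) by (rule bounded_operator.intro)
  let ?R = "SUP n\<in>{1::nat..}. SUP E\<in>cofin. INF x\<in>E - {0}. ereal (norm ((T ^^ n) x) / norm x)"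
  have necessary: "?R \<le> 1" if HC: "hypercyclic_subspace T M" for M
  proof (rule ccontr)
    assume "\<not> ?R \<le> 1"
    then obtain n E where n: "n \<ge> 1" and E: "E \<in> cofin"
      and "1 < (INF x\<in>E - {0}. ereal (norm ((T ^^ n) x) / norm x))"
      unfolding not_le less_SUP_iff by auto
    then obtain C where C: "1 < ereal C" "ereal C < (INF x\<in>E - {0}. ereal (norm ((T ^^ n) x) / norm x))"
      using ereal_dense2 by blast
    have "C * norm x \<le> norm ((T ^^ n) x)" if x: "x \<in> E" for x
    proof (cases "x = 0")
      case False
      then have "ereal C < ereal (norm ((T ^^ n) x) / norm x)"
        using x by (intro less_le_trans[OF C(2)] INF_lower) auto
      then show ?thesis using False by (simp add: field_simps)
    qed simp
    then show False using expanding_no_hypercyclic_subspace[OF n E _ _, of C M] C(1) HC by auto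
  qed
  have sufficient: "\<exists>M. hypercyclic_subspace T M" if R: "?R < \<infinity>"
  proof -
    obtain C where C: "?R < ereal C" using R less_PInf_Ex_of_nat[of ?R] by auto
    have "\<exists>x\<in>E. x \<noteq> 0 \<and> norm ((T ^^ n) x) \<le> C * norm x" if nE: "n \<ge> 1" "E \<in> cofin" for n E
    proof -
      have "(INF x\<in>E - {0}. ereal (norm ((T ^^ n) x) / norm x)) \<le> (SUP E\<in>cofin. INF x\<in>E - {0}. ereal (norm ((T ^^ n) x) / norm x))"
        using nE(2) by (rule SUP_upper)
      also have "\<dots> \<le> ?R" using nE(1) by (intro SUP_upper) auto
      also have "\<dots> < ereal C" by (rule C)
      \<comment> \<open>The infimum over the empty set is infinity, so a finite bound also
        guarantees a nonzero vector in E.\<close>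
      finally obtain x where "x \<in> E - {0}" "norm ((T ^^ n) x) / norm x < C" unfolding INF_less_iff by auto
      then show ?thesis by (intro bexI[of _ x]) (auto simp: field_simps)
    qed
    then obtain \<alpha> where "cmod \<alpha> \<le> 1"
      "\<And>E \<epsilon>. E \<in> cofin \<Longrightarrow> \<epsilon> > 0 \<Longrightarrow> \<exists>x\<in>E. norm x = 1 \<and> norm (T x - \<alpha> *\<^sub>C x) < \<epsilon>"
      using approximate_eigenvalue by metis
    moreover obtain d :: "nat \<Rightarrow> 'a" where "closure (range d) = UNIV"
      using separable_dense_sequence[OF assms(1)] .
    ultimately show ?thesis using hypercyclic_subspace_exists[OF assms(4)] by blast
  qed
  have "?R < \<infinity>" if "?R \<le> 1" using that by (rule le_less_trans) simp
  then show ?thesis using necessary sufficient by blast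
qed

end
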